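(* Let $\mathbb{P}$ be generated by a PLSEM, let $F$ be the PLSEM-function of any PLSEM generating $\mathbb{P}$, and let $\mathcal{V}=\{(i,j)\in\{1,\dots,p\}^2:\ e_j^t(\mathrm{D}F)^{-1}\partial_i^2F\not\equiv 0\}$. Then $$\mathcal{S}(\mathbb{P})=\{\sigma\text{ permutation of }\{1,\dots,p\}:\ \sigma(i)<\sigma(j)\text{ for all }(i,j)\in\mathcal{V}\}.$$
   Context: A PLSEM with DAG $D$ on $\{1,\dots,p\}$ is a system $X_j=\mu_j+\sum_{i\in\mathrm{pa}_D(j)} f_{j,i}(X_i)+\varepsilon_j$, $j=1,\dots,p$, where $\mu_j\in\mathbb{R}$, $f_{j,i}\in C^2(\mathbb{R})$, $f_{j,i}\not\equiv 0$, $\mathbb{E}[f_{j,i}(X_i)]=0$, and $\varepsilon_1,\dots,\varepsilon_p$ are mutually independent with $\varepsilon_j\sim\mathcal{N}(0,\sigma_j^2)$, $\sigma_j^2>0$; the distribution of the solution $X$ is said to be generated by the PLSEM. Its PLSEM-function is $F:\mathbb{R}^p\to\mathbb{R}^p$, $F(x)_j=\frac{1}{\sigma_j}\big(x_j-\mu_j-\sum_{i\in\mathrm{pa}_D(j)}f_{j,i}(x_i)\big)$. $\mathrm{D}F(x)$ is the Jacobian of $F$ (invertible), $\partial_i^2F(x)\in\mathbb{R}^p$ the vector of second partial derivatives of the components of $F$ with respect to $x_i$, $e_j$ the $j$-th standard basis vector; "$\not\equiv0$" means not zero for all $x\in\mathbb{R}^p$. $\mathcal{S}(\mathbb{P})$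 is the set of permutations $\sigma$ of $\{1,\dots,p\}$ for which there exists a PLSEM with some DAG $D$ generating $\mathbb{P}$ such that $\sigma(i)<\sigma(j)$ for every edge $i\to j$ of $D$. *)

theory Defs
  imports "HOL-Probability.Probability" "HOL-Combinatorics.Permutations"
begin

text \<open>Indices are 1..p. A vector of R^p is a function nat => real (only coordinates 1..p matter).
  A DAG on {1..p} is an acyclic edge relation E contained in {1..p} x {1..p}; (i,j) in E means i -> j.\<close>

definition is_dag :: "nat \<Rightarrow> (nat \<times> nat) set \<Rightarrow> bool" where
  "is_dag p E \<longleftrightarrow> E \<subseteq> {1..p} \<times> {1..p} \<and> acyclic E"

definition pa :: "(nat \<times> nat) set \<Rightarrow> nat \<Rightarrow> nat set" where
  "pa E j = {i. (i, j) \<in> E}"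

definition C2 :: "(real \<Rightarrow> real) \<Rightarrow> bool" where
  "C2 g \<longleftrightarrow> (\<forall>x. g differentiable (at x)) \<and> (\<forall>x. deriv g differentiable (at x))
            \<and> continuous_on UNIV (deriv (deriv g))"

definition plsem_generates ::
  "nat \<Rightarrow> (nat \<times> nat) set \<Rightarrow> (nat \<Rightarrow> real) \<Rightarrow> (nat \<Rightarrow> nat \<Rightarrow> real \<Rightarrow> real)
   \<Rightarrow> (nat \<Rightarrow> real) \<Rightarrow> (nat \<Rightarrow> real) measure \<Rightarrow> bool" where
  "plsem_generates p E \<mu> f s P \<longleftrightarrow>
     is_dag p E \<and>
     (\<forall>j\<in>{1..p}. s j > 0) \<and>
     (\<forall>(i, j)\<in>E. C2 (f j i) \<and> (\<exists>x. f j i x \<noteq> 0)) \<and>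
     (\<exists>(M :: (nat \<Rightarrow> real) measure) (\<epsilon> :: nat \<Rightarrow> (nat \<Rightarrow> real) \<Rightarrow> real)
        (X :: (nat \<Rightarrow> real) \<Rightarrow> (nat \<Rightarrow> real)).
        prob_space M \<and>
        prob_space.indep_vars M (\<lambda>_. borel) \<epsilon> {1..p} \<and>
        (\<forall>j\<in>{1..p}. distributed M lborel (\<epsilon> j) (\<lambda>x. ennreal (normal_density 0 (s j) x))) \<and>
        (\<forall>j\<in>{1..p}. (\<lambda>\<omega>. X \<omega> j) \<in> borel_measurable M) \<and>
        (\<forall>\<omega>\<in>space M. \<forall>j\<in>{1..p}.
            X \<omega> j = \<mu> j + (\<Sum>i\<in>pa E j. f j i (X \<omega> i)) + \<epsilon> j \<omega>) \<and>
        (\<forall>(i, j)\<in>E. integrable M (\<lambda>\<omega>. f j i (X \<omega> i)) \<and>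
                     (\<integral>\<omega>. f j i (X \<omega> i) \<partial>M) = 0) \<and>
        P = distr M (PiM {1..p} (\<lambda>_. borel)) (\<lambda>\<omega>. restrict (X \<omega>) {1..p}))"

definition generated_by_plsem :: "nat \<Rightarrow> (nat \<Rightarrow> real) measure \<Rightarrow> bool" where
  "generated_by_plsem p P \<longleftrightarrow> (\<exists>E \<mu> f s. plsem_generates p E \<mu> f s P)"

definition plsem_fun ::
  "(nat \<times> nat) set \<Rightarrow> (nat \<Rightarrow> real) \<Rightarrow> (nat \<Rightarrow> nat \<Rightarrow> real \<Rightarrow> real) \<Rightarrow> (nat \<Rightarrow> real)
   \<Rightarrow> (nat \<Rightarrow> real) \<Rightarrow> (nat \<Rightarrow> real)" where
  "plsem_fun E \<mu> f s x j = (x j - \<mu> j - (\<Sum>i\<in>pa E j. f j i (x i))) / s j"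

definition jacobian :: "((nat \<Rightarrow> real) \<Rightarrow> (nat \<Rightarrow> real)) \<Rightarrow> (nat \<Rightarrow> real) \<Rightarrow> nat \<Rightarrow> nat \<Rightarrow> real" where
  "jacobian F x k l = deriv (\<lambda>t. F (x(l := t)) k) (x l)"

definition second_partial :: "((nat \<Rightarrow> real) \<Rightarrow> (nat \<Rightarrow> real)) \<Rightarrow> nat \<Rightarrow> (nat \<Rightarrow> real) \<Rightarrow> nat \<Rightarrow> real" where
  "second_partial F i x k = deriv (\<lambda>t. deriv (\<lambda>u. F (x(i := u)) k) t) (x i)"

definition mat_inv_apply :: "nat \<Rightarrow> (nat \<Rightarrow> nat \<Rightarrow> real) \<Rightarrow> (nat \<Rightarrow> real) \<Rightarrow> (nat \<Rightarrow> real)" where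
  "mat_inv_apply p A w = (THE v. (\<forall>k\<in>{1..p}. (\<Sum>l\<in>{1..p}. A k l * v l) = w k)
                                 \<and> (\<forall>k. k \<notin> {1..p} \<longrightarrow> v k = 0))"

definition V_set :: "nat \<Rightarrow> ((nat \<Rightarrow> real) \<Rightarrow> (nat \<Rightarrow> real)) \<Rightarrow> (nat \<times> nat) set" where
  "V_set p F = {(i, j). i \<in> {1..p} \<and> j \<in> {1..p} \<and>
       (\<exists>x. mat_inv_apply p (jacobian F x) (second_partial F i x) j \<noteq> 0)}"

definition S_perms :: "nat \<Rightarrow> (nat \<Rightarrow> real) measure \<Rightarrow> (nat \<Rightarrow> nat) set" where
  "S_perms p P = {\<sigma>. \<sigma> permutes {1..p} \<and>
       (\<exists>E \<mu> f s. plsem_generates p E \<mu> f s P \<and> (\<forall>(i, j)\<in>E. \<sigma> i < \<sigma> j))}"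

end

(* A PLSEM with function F has the density const * exp(-|F|^2/2), since F is, up to scaling, a
   triangular shear. Hence two PLSEMs have the same law iff |F| = |G| pointwise.

   If G has a topological order and |F| = |G|, take a last variable x_k of that order: G_k is affine
   in x_k and the other components of G do not involve it, so |F|^2 is quadratic in x_k with constant
   leading coefficient. As F is additive and onto, this forces F to be affine in x_k up to the kernel
   of the form, which makes G_k a linear image of F. Subtracting G_k^2 from the form and iterating
   gives G = Q F with a constant matrix Q. Then (DF)^{-1} d_i^2 F = (DG)^{-1} d_i^2 G, which is
   supported on descendants of i in the graph of G.

   Conversely, if the order respects V, then the spans of the columns of DF that come late in the
   order are constant in x. Orthogonalising along this constant flag gives Q such that QF is
   triangular with constant diagonal and |QF| = |F|, and QF is the function of a PLSEM with the same
   law. *)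

theory Submission
  imports Defs "HOL-Library.Function_Algebras"
begin

section \<open>Positive semidefinite forms\<close>

text \<open>That |F| and |G| agree is known at equal arguments only, not for differences, so G
  cannot be compared with F by a theorem on isometries. The curve traced by F along x_k has known
  length at each parameter and could still bend. Two facts exclude this: F is onto, which leaves no
  room beside a line, and F is continuous along coordinates, which fixes the sign on that line.
  After a square has been subtracted the form is degenerate while F keeps all its components; hence
  statements about the form are made modulo its kernel, surjectivity included. In the converse
  direction the new model must match the law including its normalising constant, which is obtained
  from total mass one instead of a determinant of Q. The means to be removed from the new edge
  functions are computed under P itself, before the new model is realised.\<close>

instantiation "fun" :: (type, real_vector) real_vector
begin

definition scaleR_fun where "scaleR_fun c g = (\<lambda>x. c *\<^sub>R g x)"

instance
  by standard (auto simp: scaleR_fun_def fun_eq_iff algebra_simps)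

end

lemma scaleR_fun_apply [simp]: "(c *\<^sub>R g) x = c *\<^sub>R g x"
  by (simp add: scaleR_fun_def)

lemmas bilinear_expand =
  bilinear_ladd bilinear_radd bilinear_lsub bilinear_rsub bilinear_lmul bilinear_rmul

text \<open>Along \<open>t *\<^sub>R y + z\<close> the form is affine in t once \<open>B y y\<close>
  vanishes, so it stays nonnegative only if its slope \<open>2 * B y z\<close> is zero. This
  degenerate Cauchy-Schwarz inequality leads from null vectors to vectors of the kernel.\<close>

lemma psd_null_left:
  fixes B :: "'v::real_vector \<Rightarrow> 'v \<Rightarrow> real"
  assumes B: "bilinear B" and sym: "\<And>u w. B u w = B w u" and psd: "\<And>u. B u u \<ge> 0"
    and null: "B y y = 0"
  shows "B y z = 0"
proof (rule ccontr)
  assume nz: "B y z \<noteq> 0"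
  define t where "t = - (B z z + 1) / (2 * B y z)"
  have "B (t *\<^sub>R y + z) (t *\<^sub>R y + z) = 2 * t * B y z + B z z"
    using null by (simp add: bilinear_expand[OF B] sym[of z y] algebra_simps)
  also have "\<dots> = -1"
    using nz by (simp add: t_def field_simps)
  finally show False using psd[of "t *\<^sub>R y + z"] by simp
qed

section \<open>Rigidity: equal sums of squares force a linear relation\<close>

lemma signed_identity:
  fixes \<phi> :: "real \<Rightarrow> real"
  assumes cont: "continuous_on UNIV \<phi>" and pm: "\<And>t. \<phi> t = t \<or> \<phi> t = - t"
    and "\<phi> 1 = 1" "\<phi> (-1) = -1"
  shows "\<phi> t = t"
proof (rule ccontr)
  assume neq: "\<phi> t \<noteq> t"
  then have t: "t \<noteq> 0" "\<phi> t = - t" using pm[of t] by auto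
  \<comment> \<open>On the half-line of t the sign is fixed at \<open>sgn t\<close>; the opposite
    sign at t would by connectedness yield a zero of \<open>\<phi>\<close> away from the origin,
    against \<open>pm\<close>.\<close>
  define S where "S = (if t > 0 then {0<..} else {..<0::real})"
  have "connected (\<phi> ` S)"
    by (rule connected_continuous_image)
      (auto simp: S_def intro: continuous_on_subset[OF cont])
  moreover have "t \<in> S" "sgn t \<in> S" using t by (auto simp: S_def)
  moreover have "\<phi> (sgn t) = sgn t" using assms t by (cases "t > 0") auto
  ultimately have *: "connected (\<phi> ` S)" "- t \<in> \<phi> ` S" "sgn t \<in> \<phi> ` S"
    using t(2) by (auto intro: image_eqI[of _ \<phi>, OF sym])
  have "0 \<in> \<phi> ` S"
  proof (cases "t > 0")
    case True
    then show ?thesis using connectedD_interval[OF *, of 0] by simp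
  next
    case False
    then show ?thesis using connectedD_interval[OF *(1,3,2), of 0] t(1) by simp
  qed
  then obtain u where "u \<in> S" "\<phi> u = 0" by auto
  then show False using pm[of u] by (auto simp: S_def split: if_splits)
qed

text \<open>Modulo the kernel of \<open>B\<close>, the component \<open>\<gamma> t\<close> of \<open>h t\<close> orthogonal to \<open>\<A>\<close> covers the whole
  orthogonal complement of \<open>\<A>\<close> and has squared length \<open>\<alpha> * t\<^sup>2\<close>. So each sphere of that complement
  contains at most two points, the complement is at most a line, and \<open>\<gamma>\<close> is linear by continuity.\<close>

lemma rigid_curve:
  fixes B :: "'v::real_vector \<Rightarrow> 'v \<Rightarrow> real" and h :: "real \<Rightarrow> 'v"
  assumes B: "bilinear B" and sym: "\<And>u w. B u w = B w u" and psd: "\<And>u. B u u \<ge> 0"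
    and lin: "\<And>A t. A \<in> \<A> \<Longrightarrow> B A (h t) = t * B A (h 1)"
    and len: "\<And>t. B (h t) (h t) = a\<^sup>2 * t\<^sup>2"
    and cover: "\<And>y. \<exists>A\<in>\<A>. \<exists>t. \<forall>z. B y z = B A z + B (h t) z"
    and cont: "\<And>m. continuous_on UNIV (\<lambda>t. B (h t) m)"
  shows "B (h t) z = t * B (h 1) z"
proof -
  note ex = bilinear_expand[OF B]
  note null = psd_null_left[OF B sym psd]
  \<comment> \<open>\<open>g\<close> is the deviation of \<open>h\<close> from linearity. It lies in
    the orthogonal complement \<open>N\<close> of \<open>\<A>\<close>, because \<open>lin\<close>
    makes pairings with \<open>\<A>\<close> linear in t. The goal is that \<open>g\<close> is
    null.\<close>
  define g where "g t = h t - t *\<^sub>R h 1" for t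
  define N where "N = {y. \<forall>A\<in>\<A>. B A y = 0}"
  have N_lin: "x *\<^sub>R u + y *\<^sub>R w \<in> N" if "u \<in> N" "w \<in> N" for x y u w
    using that by (simp add: N_def ex)
  have gN: "g t \<in> N" for t
    using lin[of _ t] by (simp add: N_def g_def ex)
  have coverN: "\<exists>t. \<forall>z\<in>N. B y z = B (h t) z" for y
    proof -
      obtain A t where "A \<in> \<A>" "\<And>z. B y z = B A z + B (h t) z" using cover by blast
      then show ?thesis by (auto simp: N_def)
    qed
  have "B (g t1) (g t1) = 0" for t1
  proof (rule ccontr)
    assume n: "B (g t1) (g t1) \<noteq> 0"
    obtain t2 where t2: "\<And>z. z \<in> N \<Longrightarrow> B (g t1) z = B (h t2) z" using coverN by blast
    have "t2 \<noteq> 0"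
    proof
      assume "t2 = 0"
      then have "B (h t2) (g t1) = 0" using len[of 0] null by simp
      then show False using n t2[OF gN] by simp
    qed
    \<comment> \<open>\<open>m\<close> is the projection of \<open>h 1\<close> to \<open>N\<close>.
      No completeness is at hand to provide it; but on \<open>N\<close> the vector
      \<open>h t2\<close> acts as \<open>g t1\<close>, and
      \<open>h t2 = g t2 + t2 *\<^sub>R h 1\<close>, which can be solved for
      \<open>h 1\<close>.\<close>
    define m where "m = (1 / t2) *\<^sub>R g t1 + (- 1 / t2) *\<^sub>R g t2"
    have mN: "m \<in> N" unfolding m_def by (intro N_lin gN)
    have m: "B (h 1) z = B m z" if "z \<in> N" for z
      using t2[OF that] \<open>t2 \<noteq> 0\<close> by (simp add: m_def g_def ex field_simps)
    \<comment> \<open>\<open>\<gamma> t\<close> is the part of \<open>h t\<close> in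
      \<open>N\<close>. The rest is t times \<open>h 1 - m\<close>, so Pythagoras leaves a multiple
      of t^2 for the squared length of \<open>\<gamma> t\<close>.\<close>
    define \<gamma> where "\<gamma> t = 1 *\<^sub>R g t + t *\<^sub>R m" for t
    have \<gamma>N: "\<gamma> t \<in> N" for t unfolding \<gamma>_def by (intro N_lin gN mN)
    have \<gamma>: "B (\<gamma> t) z = B (h t) z" if "z \<in> N" for t z
      using m[OF that] by (simp add: \<gamma>_def g_def ex)
    have "\<gamma> 1 = m" by (simp add: \<gamma>_def g_def)
    define \<alpha> where "\<alpha> = B m m"
    have \<gamma>_len: "B (\<gamma> t) (\<gamma> t) = t\<^sup>2 * \<alpha>" for t
    proof -
      have *: "B (\<gamma> t) (\<gamma> t) = a\<^sup>2 * t\<^sup>2 - t\<^sup>2 * B (h 1 - m) (h 1 - m)" for t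
      proof -
        have "h t - \<gamma> t = t *\<^sub>R (h 1 - m)"
          by (simp add: \<gamma>_def g_def algebra_simps)
        then have "B (h t - \<gamma> t) (h t - \<gamma> t) = t\<^sup>2 * B (h 1 - m) (h 1 - m)"
          by (simp only: bilinear_lmul[OF B] bilinear_rmul[OF B])
            (simp add: power2_eq_square)
        moreover have "B (h t - \<gamma> t) (h t - \<gamma> t) = a\<^sup>2 * t\<^sup>2 - B (\<gamma> t) (\<gamma> t)"
          using \<gamma>[OF \<gamma>N, of t t] len[of t] sym[of "\<gamma> t" "h t"]
          by (simp add: bilinear_lsub[OF B] bilinear_rsub[OF B])
        ultimately show ?thesis by simp
      qed
      have "a\<^sup>2 = \<alpha> + B (h 1 - m) (h 1 - m)"
        using *[of 1] by (simp add: \<open>\<gamma> 1 = m\<close> \<alpha>_def)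
      then show ?thesis using *[of t] by (simp add: algebra_simps)
    qed
    \<comment> \<open>For y in \<open>N\<close>, agreement with \<open>\<gamma> t\<close> on
      \<open>N\<close> extends to all vectors: the difference lies in \<open>N\<close> and is
      null.\<close>
    have \<gamma>_cover: "\<exists>t. \<forall>z. B y z = B (\<gamma> t) z" if "y \<in> N" for y
    proof -
      obtain t where t: "\<And>z. z \<in> N \<Longrightarrow> B y z = B (h t) z" using coverN by blast
      have "y - \<gamma> t \<in> N" using N_lin[OF that \<gamma>N[of t], of 1 "-1"] by simp
      then have "B (y - \<gamma> t) (y - \<gamma> t) = 0"
        using t \<gamma> by (simp add: bilinear_lsub[OF B])
      then have "B (y - \<gamma> t) z = 0" for z by (rule null)
      then show ?thesis by (auto simp: bilinear_lsub[OF B])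
    qed
    \<comment> \<open>The length of \<open>g t1\<close> hinges on the pairing of
      \<open>\<gamma> t1\<close> with \<open>m\<close>, which both cases below evaluate as
      \<open>t1 * \<alpha>\<close>.\<close>
    have g_len: "B (g t1) (g t1) = 2 * t1\<^sup>2 * \<alpha> - 2 * t1 * B (\<gamma> t1) m"
    proof -
      have "B (\<gamma> t1 - t1 *\<^sub>R m) (\<gamma> t1 - t1 *\<^sub>R m) = 2 * t1\<^sup>2 * \<alpha> - 2 * t1 * B (\<gamma> t1) m"
        using \<gamma>_len[of t1] sym[of m "\<gamma> t1"]
        by (simp add: bilinear_lsub[OF B] bilinear_rsub[OF B] bilinear_lmul[OF B]
            bilinear_rmul[OF B] power2_eq_square \<alpha>_def algebra_simps)
      then show ?thesis by (simp add: \<gamma>_def)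
    qed
    show False
    proof (cases "\<alpha> = 0")
      case True
      then have "B (\<gamma> t1) m = 0" using null \<gamma>_len by simp
      then show False using g_len n True by simp
    next
      case False
      define \<phi> where "\<phi> t = B (\<gamma> t) m / \<alpha>" for t
      \<comment> \<open>\<open>\<gamma>\<close> must reach \<open>s *\<^sub>R m\<close>, and only
        the parameters s and -s have the right length. Using this for s and for -s yields
        \<open>pm\<close>.\<close>
      have two: "\<phi> s = s \<or> \<phi> (- s) = s" for s
      proof -
        have "s *\<^sub>R m \<in> N" using N_lin[OF mN mN, of s 0] by simp
        then obtain t where t: "\<And>z. B (s *\<^sub>R m) z = B (\<gamma> t) z" using \<gamma>_cover by blast
        have "s\<^sup>2 * \<alpha> = B (s *\<^sub>R m) (s *\<^sub>R m)" by (simp add: ex \<alpha>_def power2_eq_square)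
        also have "\<dots> = B (\<gamma> t) (s *\<^sub>R m)" by (rule t)
        also have "\<dots> = B (s *\<^sub>R m) (\<gamma> t)" by (rule sym)
        also have "\<dots> = B (\<gamma> t) (\<gamma> t)" by (rule t)
        finally have "t = s \<or> t = - s" using False by (auto simp: \<gamma>_len power2_eq_iff)
        moreover have "B (\<gamma> t) m = s * \<alpha>" using t[of m] by (simp add: ex \<alpha>_def)
        ultimately show ?thesis using False by (auto simp: \<phi>_def)
      qed
      have pm: "\<phi> s = s \<or> \<phi> s = - s" for s
        using two[of s] two[of "- s"] by auto
      have "\<phi> 1 = 1" using False by (simp add: \<phi>_def \<open>\<gamma> 1 = m\<close> \<alpha>_def)
      moreover from this have "\<phi> (-1) = -1" using two[of "-1"] by auto
      moreover have "continuous_on UNIV \<phi>"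
        unfolding \<phi>_def \<gamma>[OF mN] by (intro continuous_intros cont) (use False in auto)
      ultimately have "\<phi> t1 = t1" using signed_identity[OF _ pm] by blast
      then have "B (\<gamma> t1) m = t1 * \<alpha>" using False by (simp add: \<phi>_def field_simps)
      then show False using g_len n by (simp add: power2_eq_square)
    qed
  qed
  then have "B (g t) z = 0" by (rule null)
  then show ?thesis by (simp add: g_def ex)
qed

text \<open>The induction adds an index k of largest rank, so among the components present only
  \<open>G k\<close> depends on x_k. F stays fixed while B loses one square per step, which is why
  \<open>cover\<close> asks for surjectivity only up to the kernel of B. Semidefiniteness and a base
  point are recovered from \<open>cover\<close> and \<open>sq\<close> each time.\<close>

lemma linear_of_square_sum:
  fixes F :: "('i \<Rightarrow> real) \<Rightarrow> 'v::real_vector" and G :: "'i \<Rightarrow> ('i \<Rightarrow> real) \<Rightarrow> real"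
    and c :: "'i \<Rightarrow> nat" and B :: "'v \<Rightarrow> 'v \<Rightarrow> real"
  assumes fin: "finite I"
    and add: "\<And>k x x' s t. F (x(k := s)) - F (x(k := t)) = F (x'(k := s)) - F (x'(k := t))"
    and diag: "\<And>k x s t. k \<in> I \<Longrightarrow> G k (x(k := s)) = G k (x(k := t)) + a k * (s - t)"
    and a: "\<And>k. k \<in> I \<Longrightarrow> a k \<noteq> 0"
    and tri: "\<And>k l x t. k \<in> I \<Longrightarrow> l \<in> I \<Longrightarrow> l \<noteq> k \<Longrightarrow> c l \<le> c k \<Longrightarrow> G l (x(k := t)) = G l x"
    and B: "bilinear B" and sym: "\<And>u w. B u w = B w u"
    and cont: "\<And>m k x. k \<in> I \<Longrightarrow> continuous_on UNIV (\<lambda>t. B (F (x(k := t))) m)"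
    and cover: "\<And>y. \<exists>x. \<forall>z. B y z = B (F x) z"
    and sq: "\<And>x. B (F x) (F x) = (\<Sum>k\<in>I. (G k x)\<^sup>2)"
  shows "\<forall>k\<in>I. \<exists>L. linear L \<and> (\<forall>x. G k x = L (F x))"
  using fin diag a tri B sym cont cover sq
proof (induction I arbitrary: B rule: finite_ranking_induct[where f = c])
  case empty
  then show ?case by simp
next
  case (insert k S)
  note B = insert.prems(4) and sym = insert.prems(5) and cover = insert.prems(7)
    and sq = insert.prems(8)
  note ex = bilinear_expand[OF B]
  show ?case
  proof (cases "k \<in> S")
    case True
    then have "insert k S = S" by auto
    then show ?thesis using insert.IH[of B] insert.prems by simp
  next
    case False
    have psd: "B y y \<ge> 0" for y
    proof -
      obtain x where x: "\<And>z. B y z = B (F x) z" using cover by blast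
      have "B y y = B (F x) (F x)" using x[of y] x[of "F x"] sym[of y "F x"] by simp
      then show ?thesis by (simp add: sq sum_nonneg)
    qed
    \<comment> \<open>A base point whose image lies in the kernel; the squares sum to zero there, so
      \<open>G k x0 = 0\<close>.\<close>
    obtain x0 where x0: "\<And>z. B (F x0) z = 0"
      using cover[of 0] by (auto simp: bilinear_lzero[OF B])
    define \<alpha> where "\<alpha> = a k"
    have \<alpha>: "\<alpha> \<noteq> 0" using insert.prems(2) by (simp add: \<alpha>_def)
    have diagk: "G k (x(k := s)) = G k (x(k := t)) + \<alpha> * (s - t)" for x s t
      unfolding \<alpha>_def by (rule insert.prems(1)) simp
    have G0: "G k x0 = 0"
      using sq[of x0] x0[of "F x0"] insert.hyps(1) False
      by (simp add: add_nonneg_eq_0_iff sum_nonneg)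
    define h where "h t = F (x0(k := x0 k + t)) - F x0" for t
    have split: "F (x(k := x0 k + t)) = F (x(k := x0 k)) + h t" for x t
      using add[of x k "x0 k + t" "x0 k" x0] by (simp add: h_def algebra_simps)
    define R where "R x = (\<Sum>l\<in>S. (G l x)\<^sup>2)" for x
    have R: "R (x(k := t)) = R x" for x t
      unfolding R_def using insert.prems(3) insert.hyps False
      by (intro sum.cong refl) (metis insertCI)
    have BF: "B (F x) (F x) = R x + (G k x)\<^sup>2" for x
      using insert.hyps(1) False by (simp add: sq R_def)
    \<comment> \<open>At \<open>x0\<close> this gives the length of \<open>h t\<close>; subtracting
      that length and the value at t = 0 leaves the cross term \<open>mixed\<close>.\<close>
    have full: "B (F (x(k := x0 k)) + h t) (F (x(k := x0 k)) + h t)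
        = R x + (G k (x(k := x0 k)) + \<alpha> * t)\<^sup>2" for x t
      using diagk[of x "x0 k + t" "x0 k"] unfolding split[symmetric] BF R
      by simp
    have len: "B (h t) (h t) = \<alpha>\<^sup>2 * t\<^sup>2" for t
    proof -
      have "R x0 = 0" using BF[of x0] by (simp add: x0 G0)
      then show ?thesis
        using full[of x0 t] sym[of "h t" "F x0"] by (simp add: ex x0 G0 power_mult_distrib)
    qed
    have mixed: "B (F (x(k := x0 k))) (h t) = t * (\<alpha> * G k (x(k := x0 k)))" for x t
      using full[of x t] BF[of "x(k := x0 k)"] len[of t] sym[of "h t" "F (x(k := x0 k))"]
      by (simp add: ex R power2_eq_square algebra_simps)
    have rigid: "B (h t) z = t * B (h 1) z" for t z
    proof (rule rigid_curve[OF B sym psd])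
      show "B A (h t) = t * B A (h 1)" if "A \<in> range (\<lambda>x. F (x(k := x0 k)))" for A t
        using that mixed[of _ t] mixed[of _ 1] by auto
      show "B (h t) (h t) = \<alpha>\<^sup>2 * t\<^sup>2" for t by (rule len)
      show "\<exists>A\<in>range (\<lambda>x. F (x(k := x0 k))). \<exists>t. \<forall>z. B y z = B A z + B (h t) z" for y
      proof -
        obtain x where x: "\<And>z. B y z = B (F x) z" using cover by blast
        have "F x = F (x(k := x0 k)) + h (x k - x0 k)"
          using split[of x "x k - x0 k"] by simp
        then have "\<forall>z. B y z = B (F (x(k := x0 k))) z + B (h (x k - x0 k)) z"
          using x by (simp add: bilinear_ladd[OF B])
        then show ?thesis by blast
      qed
      show "continuous_on UNIV (\<lambda>t. B (h t) m)" for m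
      proof -
        have "continuous_on UNIV ((\<lambda>t. B (F (x0(k := t))) m) \<circ> (\<lambda>t. x0 k + t))"
          by (intro continuous_on_compose continuous_intros
              continuous_on_subset[OF insert.prems(6)]) auto
        then show ?thesis by (simp add: h_def bilinear_lsub[OF B] x0 o_def)
      qed
    qed
    \<comment> \<open>By \<open>mixed\<close> and \<open>rigid\<close>, \<open>B (h 1) (F x)\<close>
      equals \<open>\<alpha> * G k x\<close>; hence the divisor.\<close>
    define L where "L y = B (h 1) y / \<alpha>" for y
    have linL: "linear L"
      by (rule linearI) (simp_all add: L_def ex add_divide_distrib)
    have GL: "G k x = L (F x)" for x
    proof -
      have "F x = F (x(k := x0 k)) + h (x k - x0 k)"
        using split[of x "x k - x0 k"] by simp
      then have "B (h 1) (F x) = \<alpha> * G k (x(k := x0 k)) + (x k - x0 k) * \<alpha>\<^sup>2"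
        using mixed[of x 1] rigid[of "x k - x0 k" "h 1"] len[of 1]
          sym[of "h 1" "F (x(k := x0 k))"] sym[of "h 1" "h (x k - x0 k)"]
        by (simp add: bilinear_radd[OF B])
      moreover have "G k x = G k (x(k := x0 k)) + \<alpha> * (x k - x0 k)"
        using diagk[of x "x k" "x0 k"] by simp
      ultimately have "B (h 1) (F x) = \<alpha> * G k x"
        by (simp add: power2_eq_square distrib_left)
      then show ?thesis using \<alpha> by (simp add: L_def)
    qed
    define B' where "B' u w = B u w - L u * L w" for u w
    have "\<forall>k\<in>S. \<exists>L. linear L \<and> (\<forall>x. G k x = L (F x))"
    proof (rule insert.IH[of B'])
      show "bilinear B'"
        unfolding bilinear_def B'_def
        by (auto intro!: linearI simp: ex linear_add[OF linL] linear_cmul[OF linL] algebra_simps)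
      show "B' u w = B' w u" for u w using sym by (simp add: B'_def)
      have "L (F (x(i := t))) = B (F (x(i := t))) (h 1) / \<alpha>" for x i t
        by (simp add: L_def sym)
      then show "continuous_on UNIV (\<lambda>t. B' (F (x(i := t))) m)" if "i \<in> S" for i x m
        unfolding B'_def using that \<alpha> by (auto intro!: continuous_intros insert.prems(6))
      \<comment> \<open>L is itself a pairing with \<open>h 1\<close>, so vectors that agree modulo
        the kernel of B have the same L and agree modulo the kernel of \<open>B'\<close>.\<close>
      show "\<exists>x. \<forall>z. B' y z = B' (F x) z" for y
      proof -
        obtain x where x: "\<And>z. B y z = B (F x) z" using cover by blast
        then have "L y = L (F x)" by (metis L_def sym)
        then show ?thesis using x by (auto simp: B'_def)
      qed
      show "B' (F x) (F x) = (\<Sum>k\<in>S. (G k x)\<^sup>2)" for x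
        by (simp add: B'_def BF R_def GL power2_eq_square)
    qed (use insert.prems in auto)
    then show ?thesis using linL GL by auto
  qed
qed

text \<open>Gram-Schmidt from the end of a flag. \<open>v k t\<close> stands for column k of DF as a
  function of its own coordinate; \<open>flag\<close> says, tested with linear functionals, that it
  does not move modulo the later columns. \<open>I\<close> holds the columns still to be treated.
  Those in \<open>J - I\<close> lie in the kernel of B, which the last hypothesis confines to their
  span together with \<open>Z\<close>; independence then makes the next column have positive
  length.\<close>

lemma triangular_squares:
  fixes v :: "'i \<Rightarrow> real \<Rightarrow> 'v::real_vector" and B :: "'v \<Rightarrow> 'v \<Rightarrow> real" and c :: "'i \<Rightarrow> nat"
  assumes fin: "finite I" and "I \<subseteq> J"
    and flag: "\<And>\<phi> k t. linear \<phi> \<Longrightarrow> k \<in> J \<Longrightarrow> (\<And>l s. l \<in> J \<Longrightarrow> c k < c l \<Longrightarrow> \<phi> (v l s) = (0::real))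
      \<Longrightarrow> \<phi> (v k t) = \<phi> (v k 0)"
    and indep: "\<And>k. k \<in> J \<Longrightarrow> v k 0 \<notin> span (Z \<union> (\<lambda>l. v l 0) ` (J - {k}))"
    and spanning: "\<And>y. y \<in> span (Z \<union> (\<lambda>l. v l 0) ` J)"
    and "bilinear B" and "\<And>u w. B u w = B w u" and "\<And>u. B u u \<ge> 0"
    and "\<And>y z. y \<in> Z \<Longrightarrow> B y z = 0"
    and "\<And>l t z. l \<in> J - I \<Longrightarrow> B (v l t) z = 0"
    and "\<And>y. (\<And>z. B y z = 0) \<Longrightarrow> y \<in> span (Z \<union> (\<lambda>l. v l 0) ` (J - I))"
  shows "\<exists>L. (\<forall>k\<in>I. linear (L k)
      \<and> (\<forall>l\<in>J. \<forall>t. c k < c l \<longrightarrow> L k (v l t) = 0) \<and> (\<exists>a>0. \<forall>t. L k (v k t) = a))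
      \<and> (\<forall>y. B y y = (\<Sum>k\<in>I. (L k y :: real)\<^sup>2))"
  using fin assms(2,6-)
proof (induction I arbitrary: B rule: finite_ranking_induct[where f = c])
  case empty
  note ex = bilinear_expand[OF empty.prems(2)]
  have "span (Z \<union> (\<lambda>l. v l 0) ` J) \<subseteq> {y. \<forall>z. B y z = 0}"
    using empty.prems
    by (intro span_minimal subspaceI) (auto simp: ex bilinear_lzero[OF empty.prems(2)] bilinear_rzero[OF empty.prems(2)])
  then show ?case using spanning by auto
next
  case (insert k S)
  note B = insert.prems(2) and sym = insert.prems(3) and psd = insert.prems(4)
    and kerZ = insert.prems(5) and killed = insert.prems(6) and ker = insert.prems(7)
  note ex = bilinear_expand[OF B]
  show ?case
  proof (cases "k \<in> S")
    case True
    then have "insert k S = S" by auto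
    then show ?thesis using insert.IH[of B] insert.prems by simp
  next
    case False
    define u where "u = v k 0"
    have kJ: "k \<in> J" using insert.prems(1) by simp
    have "B u u \<noteq> 0"
    proof
      assume "B u u = 0"
      then have "B u z = 0" for z by (rule psd_null_left[OF B sym psd])
      then have "u \<in> span (Z \<union> (\<lambda>l. v l 0) ` (J - insert k S))" by (rule ker)
      also have "\<dots> \<subseteq> span (Z \<union> (\<lambda>l. v l 0) ` (J - {k}))"
        by (intro span_mono) auto
      finally show False using indep[OF kJ] by (simp add: u_def)
    qed
    then have pos: "B u u > 0" using psd[of u] by simp
    define a where "a = sqrt (B u u)"
    have a: "a > 0" "a * a = B u u" using pos by (simp_all add: a_def)
    \<comment> \<open>As k has largest rank in \<open>insert k S\<close>, an index beyond k lies
      outside it, and its columns are already in the kernel.\<close>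
    have later: "B (v l t) z = 0" if "l \<in> J" "c k < c l" for l t z
      using that insert.hyps(2)[of l] killed[of l] by auto
    \<comment> \<open>For fixed z, pairing with z is a functional that kills the later columns, so
      \<open>flag\<close> freezes column k at u.\<close>
    have const: "B (v k t) z = B u z" for t z
      unfolding u_def
      by (rule flag[where \<phi> = "\<lambda>y. B y z"]) (use later kJ B in \<open>auto simp: bilinear_def\<close>)
    define L where "L y = B u y / a" for y
    have linL: "linear L"
      by (rule linearI) (simp_all add: L_def ex add_divide_distrib)
    have LL: "L y * L z = B u y * B u z / B u u" for y z
      using a by (simp add: L_def)
    have Lk: "L (v k t) = a" for t
      using const[of t u] a sym[of u "v k t"] by (simp add: L_def field_simps)
    define B' where "B' y w = B y w - L y * L w" for y w
    have "\<exists>L. (\<forall>k\<in>S. linear (L k)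
        \<and> (\<forall>l\<in>J. \<forall>t. c k < c l \<longrightarrow> L k (v l t) = 0) \<and> (\<exists>a>0. \<forall>t. L k (v k t) = a))
        \<and> (\<forall>y. B' y y = (\<Sum>k\<in>S. (L k y :: real)\<^sup>2))"
    proof (rule insert.IH[of B'])
      show "S \<subseteq> J" using insert.prems(1) by simp
      show "bilinear B'"
        unfolding bilinear_def B'_def
        by (auto intro!: linearI simp: ex linear_add[OF linL] linear_cmul[OF linL] algebra_simps)
      show "B' y w = B' w y" for y w using sym by (simp add: B'_def)
      \<comment> \<open>\<open>B' y y\<close> is the squared length of y minus its projection onto
        u.\<close>
      show "B' y y \<ge> 0" for y
      proof -
        have "B (y - (B u y / B u u) *\<^sub>R u) (y - (B u y / B u u) *\<^sub>R u) = B' y y"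
          using pos sym[of y u] by (simp add: ex B'_def LL)
        then show ?thesis using psd by metis
      qed
      show "B' y z = 0" if "y \<in> Z" for y z
        using kerZ[OF that] sym[of u y] by (simp add: B'_def L_def)
      show "B' (v l t) z = 0" if "l \<in> J - S" for l t z
      proof (cases "l = k")
        case True
        then show ?thesis using const[of t z] Lk[of t] a by (simp add: B'_def L_def)
      next
        case False
        then have "B (v l t) z = 0" for z using killed that by auto
        then show ?thesis using sym[of u "v l t"] by (simp add: B'_def L_def)
      qed
      \<comment> \<open>A vector in the kernel of \<open>B'\<close> falls into the kernel of B once
        its u-component is removed, so the kernel grows by no more than column k.\<close>
      show "y \<in> span (Z \<union> (\<lambda>l. v l 0) ` (J - S))" if "\<And>z. B' y z = 0" for y
      proof -
        have "B (y - (L y / a) *\<^sub>R u) z = 0" for z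
          using that[of z] a by (simp add: B'_def ex L_def)
        then have "y - (L y / a) *\<^sub>R u \<in> span (Z \<union> (\<lambda>l. v l 0) ` (J - insert k S))"
          by (rule ker)
        then have "y \<in> span (insert u (Z \<union> (\<lambda>l. v l 0) ` (J - insert k S)))"
          by (auto simp: span_breakdown_eq)
        also have "insert u (Z \<union> (\<lambda>l. v l 0) ` (J - insert k S)) = Z \<union> (\<lambda>l. v l 0) ` (J - S)"
          using False kJ by (auto simp: u_def)
        finally show ?thesis .
      qed
    qed
    then obtain L' where L':
      "\<And>j. j \<in> S \<Longrightarrow> linear (L' j)"
      "\<And>j l t. j \<in> S \<Longrightarrow> l \<in> J \<Longrightarrow> c j < c l \<Longrightarrow> L' j (v l t) = 0"
      "\<And>j. j \<in> S \<Longrightarrow> \<exists>a>0. \<forall>t. L' j (v j t) = a"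
      "\<And>y. B' y y = (\<Sum>j\<in>S. (L' j y)\<^sup>2)" by blast
    define L'' where "L'' = L'(k := L)"
    show ?thesis
    proof (intro exI[of _ L''] conjI ballI allI impI)
      fix j assume "j \<in> insert k S"
      then consider "j = k" | "j \<in> S" "j \<noteq> k" by auto
      note j = this
      show "linear (L'' j)" using j linL L'(1) by cases (auto simp: L''_def)
      show "L'' j (v l t) = 0" if "l \<in> J" "c j < c l" for l t
        using j
      proof cases
        case 1
        then show ?thesis using later[of l t u] sym[of u "v l t"] that by (simp add: L''_def L_def)
      next
        case 2
        then show ?thesis using L'(2) that by (simp add: L''_def)
      qed
      show "\<exists>a>0. \<forall>t. L'' j (v j t) = a"
        using j L'(3) Lk a(1) by cases (auto simp: L''_def)
    next
      fix y
      have "(\<Sum>j\<in>S. (L'' j y)\<^sup>2) = (\<Sum>j\<in>S. (L' j y)\<^sup>2)"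
        using False by (intro sum.cong) (auto simp: L''_def)
      then show "B y y = (\<Sum>j\<in>insert k S. (L'' j y)\<^sup>2)"
        using L'(4)[of y] insert.hyps(1) False
        by (simp add: B'_def L''_def power2_eq_square)
    qed
  qed
qed

section \<open>Additive models\<close>

(* keeps the simplifier from turning {1..p} into {Suc 0..p} *)
declare One_nat_def [simp del]

section \<open>Closure properties of C2 functions\<close>

lemma C2_iff_derivs:
  "C2 g \<longleftrightarrow> (\<exists>g' g''. (\<forall>x. (g has_real_derivative g' x) (at x))
     \<and> (\<forall>x. (g' has_real_derivative g'' x) (at x)) \<and> continuous_on UNIV g'')"
proof
  assume "C2 g"
  then show "\<exists>g' g''. (\<forall>x. (g has_real_derivative g' x) (at x))
     \<and> (\<forall>x. (g' has_real_derivative g'' x) (at x)) \<and> continuous_on UNIV g''"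
    unfolding C2_def using DERIV_deriv_iff_real_differentiable by blast
next
  assume "\<exists>g' g''. (\<forall>x. (g has_real_derivative g' x) (at x))
     \<and> (\<forall>x. (g' has_real_derivative g'' x) (at x)) \<and> continuous_on UNIV g''"
  then obtain g' g'' where g: "\<And>x. (g has_real_derivative g' x) (at x)"
    "\<And>x. (g' has_real_derivative g'' x) (at x)" "continuous_on UNIV g''" by blast
  have "deriv g = g'" "deriv g' = g''" using g DERIV_imp_deriv by blast+
  then show "C2 g" using g unfolding C2_def by (auto simp: real_differentiable_def)
qed

lemma C2_has_deriv:
  assumes "C2 g"
  shows "(g has_real_derivative deriv g x) (at x)"
    "(deriv g has_real_derivative deriv (deriv g) x) (at x)"
  using assms by (simp_all add: C2_def DERIV_deriv_iff_real_differentiable)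

lemma C2_affine: "C2 (\<lambda>t. a * t + b)"
  unfolding C2_iff_derivs
  by (intro exI[of _ "\<lambda>_. a"] exI[of _ "\<lambda>_. 0"]) (auto intro!: derivative_eq_intros)

lemma C2_cmult: "C2 g \<Longrightarrow> C2 (\<lambda>t. a * g t)"
  unfolding C2_iff_derivs by (metis DERIV_cmult continuous_on_mult_left)

lemma C2_add:
  assumes "C2 g" "C2 h"
  shows "C2 (\<lambda>t. g t + h t)"
proof -
  obtain g' g'' h' h'' where
    "\<And>x. (g has_real_derivative g' x) (at x)" "\<And>x. (g' has_real_derivative g'' x) (at x)"
    "\<And>x. (h has_real_derivative h' x) (at x)" "\<And>x. (h' has_real_derivative h'' x) (at x)"
    "continuous_on UNIV g''" "continuous_on UNIV h''"
    using assms unfolding C2_iff_derivs by blast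
  then show ?thesis
    unfolding C2_iff_derivs
    by (intro exI[of _ "\<lambda>x. g' x + h' x"] exI[of _ "\<lambda>x. g'' x + h'' x"])
      (auto intro!: DERIV_add continuous_on_add)
qed

lemma C2_sum: "(\<And>i. i \<in> S \<Longrightarrow> C2 (g i)) \<Longrightarrow> C2 (\<lambda>t. \<Sum>i\<in>S. g i t)"
  by (induction S rule: infinite_finite_induct)
    (use C2_affine[of 0 0] in \<open>auto intro: C2_add\<close>)

lemma C2_continuous: "C2 g \<Longrightarrow> continuous_on UNIV g"
  using C2_has_deriv(1) DERIV_continuous_on by blast

text \<open>The deterministic side of a PLSEM. Acyclicity is recorded as a rank c increasing along
  edges, so that inductions can remove a node of largest rank. Any compatible c may be inserted: an
  ancestor count or a given permutation.\<close>

locale additive_model =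
  fixes p :: nat and E :: "(nat \<times> nat) set" and \<mu> :: "nat \<Rightarrow> real"
    and f :: "nat \<Rightarrow> nat \<Rightarrow> real \<Rightarrow> real" and s :: "nat \<Rightarrow> real" and c :: "nat \<Rightarrow> nat"
  assumes edges: "E \<subseteq> {1..p} \<times> {1..p}"
    and rank: "(i, j) \<in> E \<Longrightarrow> c i < c j"
    and s_pos: "j \<in> {1..p} \<Longrightarrow> s j > 0"
    and C2_f: "(i, j) \<in> E \<Longrightarrow> C2 (f j i)"
begin

abbreviation F :: "(nat \<Rightarrow> real) \<Rightarrow> nat \<Rightarrow> real" where
  "F \<equiv> plsem_fun E \<mu> f s"

text \<open>\<open>H k l\<close> is the part of component k of F that depends on x_l. Column l of
  DF, given by \<open>D1\<close>, is therefore a function of x_l alone, with derivative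
  \<open>D2\<close>. The diagonal part is linear and contributes nothing to
  \<open>D2\<close>.\<close>

definition H :: "nat \<Rightarrow> nat \<Rightarrow> real \<Rightarrow> real" where
  "H k l t = (if l = k then t / s k else if l \<in> pa E k then - f k l t / s k else 0)"

definition D1 :: "nat \<Rightarrow> nat \<Rightarrow> real \<Rightarrow> real" where
  "D1 k l t = (if l = k then 1 / s k else if l \<in> pa E k then - deriv (f k l) t / s k else 0)"

definition D2 :: "nat \<Rightarrow> nat \<Rightarrow> real \<Rightarrow> real" where
  "D2 k l t = (if l \<in> pa E k then - deriv (deriv (f k l)) t / s k else 0)"

lemma pa_subset: "pa E j \<subseteq> {1..p}"
  using edges by (auto simp: pa_def)

lemma finite_pa [simp]: "finite (pa E j)"
  using pa_subset finite_subset by blast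

lemma pa_rank: "i \<in> pa E j \<Longrightarrow> c i < c j"
  using rank by (auto simp: pa_def)

lemma pa_irrefl [simp]: "j \<notin> pa E j"
  using pa_rank by blast

lemma pa_C2: "i \<in> pa E j \<Longrightarrow> C2 (f j i)"
  using C2_f by (auto simp: pa_def)

lemma H_deriv: "(H k l has_real_derivative D1 k l t) (at t)"
  using C2_has_deriv(1)[OF pa_C2, of l k t]
  by (auto simp: H_def[abs_def] D1_def intro!: DERIV_cdivide DERIV_minus DERIV_ident)

lemma D1_deriv: "(D1 k l has_real_derivative D2 k l t) (at t)"
proof (cases "l \<in> pa E k")
  case True
  then have "D1 k l = (\<lambda>t. - deriv (f k l) t / s k)" "D2 k l t = - deriv (deriv (f k l)) t / s k"
    by (auto simp: D1_def D2_def fun_eq_iff)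
  then show ?thesis
    using C2_has_deriv(2)[OF pa_C2[OF True], of t] by (auto intro!: DERIV_cdivide DERIV_minus)
next
  case False
  then have "D1 k l = (\<lambda>t. D1 k l 0)" "D2 k l t = 0"
    by (auto simp: D1_def D2_def fun_eq_iff)
  then show ?thesis by (metis DERIV_const)
qed

lemma C2_H: "C2 (H k l)"
proof -
  have "C2 (\<lambda>t. - (1 / s k) * f k l t)" if "l \<in> pa E k"
    by (intro C2_cmult pa_C2 that)
  then show ?thesis
    using C2_affine[of "1 / s k" 0] C2_affine[of 0 0]
    by (cases "l = k"; cases "l \<in> pa E k") (simp_all add: H_def[abs_def])
qed

lemma F_sum:
  assumes "k \<in> {1..p}"
  shows "F x k = (\<Sum>l\<in>{1..p}. H k l (x l)) - \<mu> k / s k"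
proof -
  have "(\<Sum>l\<in>{1..p}. H k l (x l)) = (\<Sum>l\<in>insert k (pa E k). H k l (x l))"
    using assms pa_subset[of k] by (intro sum.mono_neutral_right) (auto simp: H_def)
  also have "\<dots> = x k / s k + (\<Sum>l\<in>pa E k. - f k l (x l) / s k)"
    by (simp, intro arg_cong2[where f = "(+)"] sum.cong) (auto simp: H_def)
  finally show ?thesis
    by (simp add: plsem_fun_def diff_divide_distrib sum_divide_distrib sum_negf)
qed

lemma F_upd: "F (x(l := t)) k = F (x(l := u)) k + (H k l t - H k l u)"
proof -
  have *: "(\<Sum>i\<in>pa E k. f k i ((x(l := t)) i))
      = (\<Sum>i\<in>pa E k - {l}. f k i (x i)) + (if l \<in> pa E k then f k l t else 0)" for t
  proof (cases "l \<in> pa E k")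
    case True
    then have "(\<Sum>i\<in>pa E k. f k i ((x(l := t)) i))
        = f k l t + (\<Sum>i\<in>pa E k - {l}. f k i ((x(l := t)) i))"
      by (subst sum.remove[of _ l]) auto
    also have "(\<Sum>i\<in>pa E k - {l}. f k i ((x(l := t)) i)) = (\<Sum>i\<in>pa E k - {l}. f k i (x i))"
      by (intro sum.cong) auto
    finally show ?thesis using True by simp
  qed (auto intro!: sum.cong)
  show ?thesis
    unfolding plsem_fun_def * by (auto simp: H_def diff_divide_distrib add_divide_distrib)
qed

lemma F_has_partial: "((\<lambda>t. F (x(l := t)) k) has_real_derivative D1 k l t) (at t)"
proof -
  have "(\<lambda>t. F (x(l := t)) k) = (\<lambda>t. F (x(l := 0)) k + (H k l t - H k l 0))"
    using F_upd by blast
  then show ?thesis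
    by (auto intro!: derivative_eq_intros H_deriv)
qed

lemma jacobian_F: "jacobian F x k l = D1 k l (x l)"
  unfolding jacobian_def by (intro DERIV_imp_deriv F_has_partial)

lemma second_partial_F: "second_partial F i x k = D2 k i (x i)"
proof -
  have "(\<lambda>t. deriv (\<lambda>u. F (x(i := u)) k) t) = D1 k i"
    using DERIV_imp_deriv[OF F_has_partial] by blast
  then show ?thesis
    unfolding second_partial_def by (simp add: DERIV_imp_deriv[OF D1_deriv])
qed

section \<open>Triangular systems and the inverse of the Jacobian\<close>

lemma recursive_system:
  assumes local: "\<And>x y j. (\<And>i. i \<in> pa E j \<Longrightarrow> x i = y i) \<Longrightarrow> r j x = (r j y :: real)"
  shows "\<exists>x. \<forall>j. x j = r j x"
proof -
  \<comment> \<open>Recursion along the rank: \<open>cut\<close> hides all values except those of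
    smaller rank, and the parents are among these.\<close>
  define R where "R = {(i, j). c i < c j}"
  have "R = inv_image less_than c" by (auto simp: R_def)
  then have "wf R" by simp
  define x where "x = wfrec R (\<lambda>x j. r j x)"
  have "x j = r j x" for j
  proof -
    have "x j = r j (cut x R j)"
      unfolding x_def by (rule wfrec[OF \<open>wf R\<close>])
    also have "\<dots> = r j x"
      by (rule local) (auto simp: cut_def R_def pa_rank)
    finally show ?thesis .
  qed
  then show ?thesis by blast
qed

lemma F_surj: "\<exists>x. \<forall>k\<in>{1..p}. F x k = y k"
proof -
  have "\<exists>x. \<forall>k. x k = s k * y k + \<mu> k + (\<Sum>i\<in>pa E k. f k i (x i))"
    by (rule recursive_system) (simp cong: sum.cong)
  then obtain x where x: "\<And>k. x k = s k * y k + \<mu> k + (\<Sum>i\<in>pa E k. f k i (x i))" by blast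
  have "F x k = y k" if "k \<in> {1..p}" for k
    using x[of k] s_pos[OF that] by (simp add: plsem_fun_def)
  then show ?thesis by blast
qed

lemma D1_row:
  assumes "k \<in> {1..p}"
  shows "(\<Sum>l\<in>{1..p}. D1 k l (x l) * v l) = (v k - (\<Sum>l\<in>pa E k. deriv (f k l) (x l) * v l)) / s k"
proof -
  have "(\<Sum>l\<in>{1..p}. D1 k l (x l) * v l) = (\<Sum>l\<in>insert k (pa E k). D1 k l (x l) * v l)"
    using assms pa_subset[of k] by (intro sum.mono_neutral_right) (auto simp: D1_def)
  also have "\<dots> = v k / s k + (\<Sum>l\<in>pa E k. - (deriv (f k l) (x l) * v l) / s k)"
    by (simp, intro arg_cong2[where f = "(+)"] sum.cong) (auto simp: D1_def)
  finally show ?thesis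
    by (simp add: diff_divide_distrib sum_divide_distrib sum_negf)
qed

lemma D1_solvable: "\<exists>v. \<forall>k\<in>{1..p}. (\<Sum>l\<in>{1..p}. D1 k l (x l) * v l) = w k"
proof -
  have "\<exists>v. \<forall>k. v k = s k * w k + (\<Sum>i\<in>pa E k. deriv (f k i) (x i) * v i)"
    by (rule recursive_system) (simp cong: sum.cong)
  then obtain v where v: "\<And>k. v k = s k * w k + (\<Sum>i\<in>pa E k. deriv (f k i) (x i) * v i)" by blast
  have "(\<Sum>l\<in>{1..p}. D1 k l (x l) * v l) = w k" if "k \<in> {1..p}" for k
    using v[of k] s_pos[OF that] by (simp add: D1_row[OF that])
  then show ?thesis by blast
qed

text \<open>Rows of rank at most m involve only unknowns of rank at most m, so the system may be cut
  off there. With m the rank of i, this confines the solution for the second derivative in x_i to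
  nodes of larger rank.\<close>

lemma forward_substitution:
  assumes "\<And>k. k \<in> {1..p} \<Longrightarrow> c k \<le> m \<Longrightarrow> (\<Sum>l\<in>{1..p}. D1 k l (x l) * v l) = 0"
    and "k \<in> {1..p}" "c k \<le> m"
  shows "v k = 0"
  using assms(2,3)
proof (induction "c k" arbitrary: k rule: less_induct)
  case less
  have "v l = 0" if "l \<in> pa E k" for l
    using less.hyps[of l] less.prems that pa_rank[OF that] pa_subset[of k] by auto
  then have "v k / s k = (\<Sum>l\<in>{1..p}. D1 k l (x l) * v l)"
    by (simp add: D1_row[OF less.prems(1)])
  then show ?case using assms(1)[OF less.prems] s_pos[OF less.prems(1)] by simp
qed

lemma D1_injective:
  assumes "\<And>k. k \<in> {1..p} \<Longrightarrow> (\<Sum>l\<in>{1..p}. D1 k l (x l) * v l) = 0" "k \<in> {1..p}"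
  shows "v k = 0"
  using forward_substitution[of "c k" x v k] assms by blast

text \<open>Solvability and injectivity of the Jacobian system replace the definite description in
  \<open>mat_inv_apply\<close> by any solution v. Its values outside 1..p are free, whereas the
  description fixes them to 0; hence the truncation \<open>v'\<close>.\<close>

lemma V_set_F:
  "(i, j) \<in> V_set p F \<longleftrightarrow> i \<in> {1..p} \<and> j \<in> {1..p} \<and>
    (\<exists>x v. (\<forall>k\<in>{1..p}. (\<Sum>l\<in>{1..p}. D1 k l (x l) * v l) = D2 k i (x i)) \<and> v j \<noteq> 0)"
proof -
  have "mat_inv_apply p (jacobian F x) (second_partial F i x) j = v j"
    if v: "\<And>k. k \<in> {1..p} \<Longrightarrow> (\<Sum>l\<in>{1..p}. D1 k l (x l) * v l) = D2 k i (x i)" and j: "j \<in> {1..p}"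
    for x v
  proof -
    define v' where "v' k = (if k \<in> {1..p} then v k else 0)" for k
    have "mat_inv_apply p (jacobian F x) (second_partial F i x) = v'"
      unfolding mat_inv_apply_def jacobian_F second_partial_F
    proof (rule the_equality)
      have "(\<Sum>l\<in>{1..p}. D1 k l (x l) * v' l) = (\<Sum>l\<in>{1..p}. D1 k l (x l) * v l)" for k
        by (intro sum.cong) (auto simp: v'_def)
      then show "(\<forall>k\<in>{1..p}. (\<Sum>l\<in>{1..p}. D1 k l (x l) * v' l) = D2 k i (x i))
          \<and> (\<forall>k. k \<notin> {1..p} \<longrightarrow> v' k = 0)"
        using v by (auto simp: v'_def)
    next
      fix w assume w: "(\<forall>k\<in>{1..p}. (\<Sum>l\<in>{1..p}. D1 k l (x l) * w l) = D2 k i (x i))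
          \<and> (\<forall>k. k \<notin> {1..p} \<longrightarrow> w k = 0)"
      have "w k - v k = 0" if "k \<in> {1..p}" for k
        using that w v
        by (intro D1_injective[of x "\<lambda>l. w l - v l"]) (auto simp: right_diff_distrib sum_subtractf)
      then show "w = v'" using w by (auto simp: v'_def fun_eq_iff)
    qed
    then show ?thesis using j by (simp add: v'_def)
  qed
  note eq = this
  show ?thesis
  proof
    assume "(i, j) \<in> V_set p F"
    then obtain x where ij: "i \<in> {1..p}" "j \<in> {1..p}"
      and nz: "mat_inv_apply p (jacobian F x) (second_partial F i x) j \<noteq> 0"
      by (auto simp: V_set_def)
    obtain v where "\<forall>k\<in>{1..p}. (\<Sum>l\<in>{1..p}. D1 k l (x l) * v l) = D2 k i (x i)"
      using D1_solvable[of x "\<lambda>k. D2 k i (x i)"] by blast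
    then show "i \<in> {1..p} \<and> j \<in> {1..p} \<and>
        (\<exists>x v. (\<forall>k\<in>{1..p}. (\<Sum>l\<in>{1..p}. D1 k l (x l) * v l) = D2 k i (x i)) \<and> v j \<noteq> 0)"
      using eq[of x v] nz ij by auto
  next
    assume *: "i \<in> {1..p} \<and> j \<in> {1..p} \<and>
        (\<exists>x v. (\<forall>k\<in>{1..p}. (\<Sum>l\<in>{1..p}. D1 k l (x l) * v l) = D2 k i (x i)) \<and> v j \<noteq> 0)"
    then obtain x v where "\<And>k. k \<in> {1..p} \<Longrightarrow> (\<Sum>l\<in>{1..p}. D1 k l (x l) * v l) = D2 k i (x i)"
      "v j \<noteq> 0" by blast
    then have "mat_inv_apply p (jacobian F x) (second_partial F i x) j \<noteq> 0"
      using eq[of x v] * by simp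
    then show "(i, j) \<in> V_set p F"
      using * unfolding V_set_def by blast
  qed
qed

end

section \<open>The density of the law\<close>

lemma product_sigma_finite_lborel: "product_sigma_finite (\<lambda>_::'i. lborel :: real measure)"
  by standard

text \<open>A coordinate outside S is the constant \<open>undefined\<close> on the product space.
  Including it allows integration over index sets that omit some parents.\<close>

lemma borel_measurable_PiM_coordinate:
  "(\<lambda>x. x i) \<in> borel_measurable (PiM S (\<lambda>_. lborel :: real measure))"
proof (cases "i \<in> S")
  case True
  then have "(\<lambda>x. x i) \<in> measurable (PiM S (\<lambda>_. lborel)) (lborel :: real measure)"
    by (rule measurable_component_singleton)
  then show ?thesis by simp
next
  case False
  then have "x i = undefined" if "x \<in> space (PiM S (\<lambda>_. lborel :: real measure))" for x
    using that by (auto simp: space_PiM PiE_def extensional_def)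
  then show ?thesis by (subst measurable_cong[where g = "\<lambda>_. undefined"]) auto
qed

lemma PiM_density_lborel:
  assumes "finite J" and \<phi>: "\<And>j. j \<in> J \<Longrightarrow> \<phi> j \<in> borel_measurable (borel :: real measure)"
    and prob: "\<And>j. j \<in> J \<Longrightarrow> prob_space (density lborel (\<phi> j))"
  shows "PiM J (\<lambda>j. density lborel (\<phi> j))
    = density (PiM J (\<lambda>_. lborel)) (\<lambda>y. \<Prod>j\<in>J. \<phi> j (y j))"
proof -
  \<comment> \<open>Outside J a point mass is filled in, because \<open>product_prob_space\<close>
    asks for a probability measure at every index.\<close>
  define N where "N j = (if j \<in> J then density lborel (\<phi> j) else return borel 0)" for j
  have "prob_space (N j)" for j
    using prob by (auto simp: N_def intro: prob_space_return)
  then interpret N: product_prob_space N J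
    unfolding product_prob_space_def product_prob_space_axioms_def product_sigma_finite_def
    using prob_space_imp_sigma_finite by blast
  interpret L: product_sigma_finite "\<lambda>_. lborel :: real measure"
    by (rule product_sigma_finite_lborel)
  have sets_N: "sets (N j) = sets borel" for j by (simp add: N_def)
  have "density (PiM J (\<lambda>_. lborel)) (\<lambda>y. \<Prod>j\<in>J. \<phi> j (y j)) = PiM J N"
  proof (rule N.PiM_eqI[OF \<open>finite J\<close>])
    show "sets (density (PiM J (\<lambda>_. lborel)) (\<lambda>y. \<Prod>j\<in>J. \<phi> j (y j))) = sets (PiM J N)"
      by (simp add: sets_N cong: sets_PiM_cong)
  next
    fix A assume A: "\<And>i. i \<in> J \<Longrightarrow> A i \<in> sets (N i)"
    have m[measurable]: "(\<lambda>y. \<phi> j (y j)) \<in> borel_measurable (PiM J (\<lambda>_. lborel))" if "j \<in> J" for j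
      using measurable_compose[OF borel_measurable_PiM_coordinate \<phi>[OF that]] .
    have PA: "Pi\<^sub>E J A \<in> sets (PiM J (\<lambda>_. lborel :: real measure))"
      using A \<open>finite J\<close> by (intro sets_PiM_I_finite) (auto simp: sets_N)
    have "emeasure (density (PiM J (\<lambda>_. lborel)) (\<lambda>y. \<Prod>j\<in>J. \<phi> j (y j))) (Pi\<^sub>E J A)
        = (\<integral>\<^sup>+ y. (\<Prod>j\<in>J. \<phi> j (y j)) * indicator (Pi\<^sub>E J A) y \<partial>PiM J (\<lambda>_. lborel))"
      using PA by (intro emeasure_density borel_measurable_prod_ennreal m)
    also have "\<dots> = (\<integral>\<^sup>+ y. (\<Prod>j\<in>J. \<phi> j (y j) * indicator (A j) (y j)) \<partial>PiM J (\<lambda>_. lborel))"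
    proof (intro nn_integral_cong)
      fix y assume "y \<in> space (PiM J (\<lambda>_. lborel :: real measure))"
      then have "y \<in> Pi\<^sub>E J A \<longleftrightarrow> (\<forall>j\<in>J. y j \<in> A j)" by (auto simp: space_PiM PiE_def)
      then have "indicator (Pi\<^sub>E J A) y = (\<Prod>j\<in>J. indicator (A j) (y j) :: ennreal)"
        using \<open>finite J\<close> by (auto simp: indicator_def prod_zero_iff)
      then show "(\<Prod>j\<in>J. \<phi> j (y j)) * indicator (Pi\<^sub>E J A) y
          = (\<Prod>j\<in>J. \<phi> j (y j) * indicator (A j) (y j))"
        by (simp add: prod.distrib)
    qed
    also have "\<dots> = (\<Prod>j\<in>J. \<integral>\<^sup>+ y. \<phi> j y * indicator (A j) y \<partial>lborel)"
      using A \<open>finite J\<close> \<phi> by (intro L.product_nn_integral_prod) (auto simp: sets_N)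
    also have "\<dots> = (\<Prod>j\<in>J. emeasure (N j) (A j))"
      using A \<phi> by (intro prod.cong refl) (simp add: N_def emeasure_density)
    finally show "emeasure (density (PiM J (\<lambda>_. lborel)) (\<lambda>y. \<Prod>j\<in>J. \<phi> j (y j))) (Pi\<^sub>E J A)
        = (\<Prod>j\<in>J. emeasure (N j) (A j))" .
  qed
  also have "PiM J N = PiM J (\<lambda>j. density lborel (\<phi> j))"
    by (rule PiM_cong) (auto simp: N_def)
  finally show ?thesis by simp
qed

lemma joint_distr_density:
  assumes "prob_space M" "finite J"
    and indep: "prob_space.indep_vars M (\<lambda>_. borel) \<epsilon> J"
    and dist: "\<And>j. j \<in> J \<Longrightarrow> distributed M lborel (\<epsilon> j) (\<phi> j :: real \<Rightarrow> ennreal)"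
  shows "distr M (PiM J (\<lambda>_. borel)) (\<lambda>\<omega>. \<lambda>j\<in>J. \<epsilon> j \<omega>)
    = density (PiM J (\<lambda>_. lborel)) (\<lambda>y. \<Prod>j\<in>J. \<phi> j (y j))"
proof -
  interpret prob_space M by fact
  have eps: "\<epsilon> j \<in> borel_measurable M" if "j \<in> J" for j
    using distributed_measurable[OF dist[OF that]] by simp
  have law: "density lborel (\<phi> j) = distr M borel (\<epsilon> j)" if "j \<in> J" for j
    using distributed_distr_eq_density[OF dist[OF that]]
    by (metis distr_cong sets_lborel)
  have "prob_space (density lborel (\<phi> j))" if "j \<in> J" for j
    unfolding law[OF that] using eps[OF that] by (rule prob_space_distr)
  moreover have "\<phi> j \<in> borel_measurable borel" if "j \<in> J" for j
    using distributed_borel_measurable[OF dist[OF that]] by simp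
  ultimately have "density (PiM J (\<lambda>_. lborel)) (\<lambda>y. \<Prod>j\<in>J. \<phi> j (y j))
      = PiM J (\<lambda>j. density lborel (\<phi> j))"
    using PiM_density_lborel[OF \<open>finite J\<close>] by metis
  also have "\<dots> = PiM J (\<lambda>j. distr M borel (\<epsilon> j))"
    using law by (intro PiM_cong) auto
  also have "\<dots> = distr M (PiM J (\<lambda>_. borel)) (\<lambda>\<omega>. \<lambda>j\<in>J. \<epsilon> j \<omega>)"
  \<comment> \<open>The characterisation of independence by product laws needs a nonempty index set;
    for empty J both sides are the unit mass on a one-point space.\<close>
  proof (cases "J = {}")
    case True
    then have "distr M (PiM J (\<lambda>_. borel)) (\<lambda>\<omega>. \<lambda>j\<in>J. \<epsilon> j \<omega>) = PiM J (\<lambda>j. distr M borel (\<epsilon> j))"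
    proof (intro measure_eqI)
      fix A assume "A \<in> sets (distr M (PiM J (\<lambda>_. borel)) (\<lambda>\<omega>. \<lambda>j\<in>J. \<epsilon> j \<omega>))"
      then have "A = {} \<or> A = {\<lambda>_. undefined}" using True by (auto simp: PiM_empty)
      then show "emeasure (distr M (PiM J (\<lambda>_. borel)) (\<lambda>\<omega>. \<lambda>j\<in>J. \<epsilon> j \<omega>)) A
          = emeasure (PiM J (\<lambda>j. distr M borel (\<epsilon> j))) A"
        using True
        by (auto simp: PiM_empty emeasure_distr restrict_def vimage_def emeasure_space_1)
    qed (simp add: True PiM_empty)
    then show ?thesis by simp
  next
    case False
    then show ?thesis using indep_vars_iff_distr_eq_PiM'[of J \<epsilon> "\<lambda>_. borel"] indep eps by simp
  qed
  finally show ?thesis by simp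
qed

section \<open>The noise map as a volume-preserving shear\<close>

context additive_model
begin

text \<open>The noise vector as a function of x, not divided by \<open>s j\<close>, so that the map
  has unit Jacobian. S is a parameter so that nodes can be removed one at a time.\<close>

definition residual :: "nat set \<Rightarrow> (nat \<Rightarrow> real) \<Rightarrow> nat \<Rightarrow> real" where
  "residual S x = (\<lambda>j\<in>S. x j - \<mu> j - (\<Sum>i\<in>pa E j. f j i (x i)))"

lemma f_measurable: "i \<in> pa E j \<Longrightarrow> f j i \<in> borel_measurable borel"
  by (intro borel_measurable_continuous_onI C2_continuous pa_C2)

lemma residual_measurable:
  "residual S \<in> measurable (PiM S (\<lambda>_. lborel)) (PiM S (\<lambda>_. lborel))"
  unfolding residual_def
  by (intro measurable_restrict)
    (auto intro!: borel_measurable_diff borel_measurable_sum borel_measurable_PiM_coordinate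
      measurable_compose[OF borel_measurable_PiM_coordinate f_measurable])

text \<open>A node of largest rank is a parent of no node in \<open>insert k S\<close>, so its value
  enters its own residual only.\<close>

lemma residual_insert:
  assumes "k \<notin> S" and top: "\<And>j. j \<in> S \<Longrightarrow> c j \<le> c k"
  shows "residual (insert k S) (x(k := y))
    = (residual S x)(k := y - (\<mu> k + (\<Sum>i\<in>pa E k. f k i (x i))))"
proof -
  have "(\<Sum>i\<in>pa E j. f j i ((x(k := y)) i)) = (\<Sum>i\<in>pa E j. f j i (x i))"
    if "j \<in> insert k S" for j
    using that top[of j] pa_rank[of k j] by (intro sum.cong) auto
  then show ?thesis
    using \<open>k \<notin> S\<close> by (auto simp: residual_def fun_eq_iff)
qed

text \<open>Removing a node of maximal rank turns the residual map into a shear of one coordinate, so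
  the invariance reduces to translation invariance on the line.\<close>

lemma residual_preserves_lborel:
  assumes "finite S" and "h \<in> borel_measurable (PiM S (\<lambda>_. lborel))"
  shows "(\<integral>\<^sup>+ x. h (residual S x) \<partial>PiM S (\<lambda>_. lborel)) = (\<integral>\<^sup>+ x. h x \<partial>PiM S (\<lambda>_. lborel))"
  using assms
proof (induction S arbitrary: h rule: finite_ranking_induct[where f = c])
  case empty
  show ?case
    by (intro nn_integral_cong) (auto simp: space_PiM residual_def restrict_def)
next
  case (insert k S)
  interpret L: product_sigma_finite "\<lambda>_. lborel :: real measure"
    by (rule product_sigma_finite_lborel)
  show ?case
  proof (cases "k \<in> S")
    case True
    then have "insert k S = S" by auto
    then show ?thesis using insert.IH insert.prems by simp
  next
    case False
    let ?L = "PiM S (\<lambda>_. lborel :: real measure)"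
    note h = insert.prems
    define m where "m x = \<mu> k + (\<Sum>i\<in>pa E k. f k i (x i))" for x
    \<comment> \<open>\<open>g\<close> integrates out coordinate k. For fixed x the shear translates
      that coordinate by \<open>m x\<close>, so the inner integral depends on x only through
      \<open>residual S x\<close>.\<close>
    define g where "g x = (\<integral>\<^sup>+ y. h (x(k := y)) \<partial>lborel)" for x
    have upd: "(\<lambda>y. h (z(k := y))) \<in> borel_measurable borel" if "z \<in> space ?L" for z
      using measurable_compose[OF measurable_component_update[OF that False] h]
      unfolding measurable_lborel2 .
    have g: "g \<in> borel_measurable ?L"
      unfolding g_def
      by (rule lborel.borel_measurable_nn_integral)
        (use measurable_compose[OF measurable_add_dim h] in \<open>unfold split_def\<close>)
    have "(\<integral>\<^sup>+ x. h (residual (insert k S) x) \<partial>PiM (insert k S) (\<lambda>_. lborel))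
        = (\<integral>\<^sup>+ x. \<integral>\<^sup>+ y. h (residual (insert k S) (x(k := y))) \<partial>lborel \<partial>?L)"
      by (intro L.product_nn_integral_insert insert.hyps False
          measurable_compose[OF residual_measurable h])
    also have "\<dots> = (\<integral>\<^sup>+ x. g (residual S x) \<partial>?L)"
    proof (intro nn_integral_cong)
      fix x assume "x \<in> space ?L"
      then have z: "residual S x \<in> space ?L" by (rule measurable_space[OF residual_measurable])
      have "(\<integral>\<^sup>+ y. h (residual (insert k S) (x(k := y))) \<partial>lborel)
          = (\<integral>\<^sup>+ y. h ((residual S x)(k := - m x + 1 * y)) \<partial>lborel)"
        using residual_insert[OF False insert.hyps(2)] by (simp add: m_def algebra_simps)
      also have "\<dots> = g (residual S x)"
        using nn_integral_real_affine[OF upd[OF z], of 1 "- m x"] by (simp add: g_def)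
      finally show "(\<integral>\<^sup>+ y. h (residual (insert k S) (x(k := y))) \<partial>lborel) = g (residual S x)" .
    qed
    also have "\<dots> = (\<integral>\<^sup>+ x. g x \<partial>?L)" by (rule insert.IH[OF g])
    also have "\<dots> = (\<integral>\<^sup>+ x. h x \<partial>PiM (insert k S) (\<lambda>_. lborel))"
      unfolding g_def by (rule L.product_nn_integral_insert[OF insert.hyps(1) False h, symmetric])
    finally show ?thesis .
  qed
qed

lemma solution_exists:
  obtains sol where "\<And>y j. sol y j = \<mu> j + (\<Sum>i\<in>pa E j. f j i (sol y i)) + y j"
proof -
  have "\<exists>x. \<forall>j. x j = \<mu> j + (\<Sum>i\<in>pa E j. f j i (x i)) + y j" for y
    by (rule recursive_system) (simp cong: sum.cong)
  then show thesis using that by metis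
qed

lemma solution_unique:
  assumes "\<And>j. j \<in> {1..p} \<Longrightarrow> x j = \<mu> j + (\<Sum>i\<in>pa E j. f j i (x i)) + y j"
    and "\<And>j. j \<in> {1..p} \<Longrightarrow> x' j = \<mu> j + (\<Sum>i\<in>pa E j. f j i (x' i)) + y j"
    and "j \<in> {1..p}"
  shows "x j = x' j"
  using assms(3)
proof (induction "c j" arbitrary: j rule: less_induct)
  case less
  have "x i = x' i" if "i \<in> pa E j" for i
    using less.hyps[of i] that pa_rank[OF that] pa_subset[of j] by auto
  then have "(\<Sum>i\<in>pa E j. f j i (x i)) = (\<Sum>i\<in>pa E j. f j i (x' i))"
    by (intro sum.cong) auto
  then show ?case using assms(1,2)[OF less.prems] by simp
qed

lemma solution_measurable:
  assumes sol: "\<And>y j. sol y j = \<mu> j + (\<Sum>i\<in>pa E j. f j i (sol y i)) + y j"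
  shows "(\<lambda>y. sol y j) \<in> borel_measurable (PiM S (\<lambda>_. lborel))"
proof (induction "c j" arbitrary: j rule: less_induct)
  case less
  have "(\<lambda>y. \<mu> j + (\<Sum>i\<in>pa E j. f j i (sol y i)) + y j) \<in> borel_measurable (PiM S (\<lambda>_. lborel))"
    by (intro borel_measurable_add borel_measurable_sum borel_measurable_const
        borel_measurable_PiM_coordinate measurable_compose[OF less f_measurable] pa_rank)
  then show ?case by (subst sol)
qed

text \<open>The product of the one-dimensional Gaussian constants; the unit Jacobian of
  \<open>residual\<close> adds no factor.\<close>

definition normalizer :: real where
  "normalizer = (\<Prod>j\<in>{1..p}. 1 / sqrt (2 * pi * (s j)\<^sup>2))"

lemma normalizer_pos: "normalizer > 0"
  unfolding normalizer_def by (intro prod_pos) (use s_pos in fastforce)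

text \<open>X is the solution map R applied to the noise, and R undoes \<open>residual\<close>. As
  \<open>residual\<close> preserves Lebesgue measure, X has the noise density composed with
  \<open>residual\<close>.\<close>

lemma law_density:
  assumes M: "prob_space M" "prob_space.indep_vars M (\<lambda>_. borel) \<epsilon> {1..p}"
    and dist: "\<And>j. j \<in> {1..p} \<Longrightarrow>
      distributed M lborel (\<epsilon> j) (\<lambda>x. ennreal (normal_density 0 (s j) x))"
    and X: "\<And>\<omega> j. \<omega> \<in> space M \<Longrightarrow> j \<in> {1..p} \<Longrightarrow>
      X \<omega> j = \<mu> j + (\<Sum>i\<in>pa E j. f j i (X \<omega> i)) + \<epsilon> j \<omega>"
  shows "distr M (PiM {1..p} (\<lambda>_. borel)) (\<lambda>\<omega>. restrict (X \<omega>) {1..p})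
    = density (PiM {1..p} (\<lambda>_. lborel))
        (\<lambda>x. ennreal (normalizer * exp (- (\<Sum>j\<in>{1..p}. (F x j)\<^sup>2) / 2)))"
proof -
  let ?J = "{1..p}"
  let ?L = "PiM ?J (\<lambda>_. lborel :: real measure)"
  let ?N = "PiM ?J (\<lambda>_. borel :: real measure)"
  define \<phi> where "\<phi> y = (\<Prod>j\<in>?J. ennreal (normal_density 0 (s j) (y j)))" for y :: "nat \<Rightarrow> real"
  obtain sol where sol: "\<And>y j. sol y j = \<mu> j + (\<Sum>i\<in>pa E j. f j i (sol y i)) + y j"
    using solution_exists by blast
  define R where "R y = restrict (sol y) ?J" for y
  have sets_L: "sets ?L = sets ?N" by (intro sets_PiM_cong) auto
  have R[measurable]: "R \<in> measurable ?L ?N"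
    unfolding R_def by (intro measurable_restrict solution_measurable sol)
  have \<phi>[measurable]: "\<phi> \<in> borel_measurable ?L"
    unfolding \<phi>_def
    by (intro borel_measurable_prod_ennreal measurable_compose[OF borel_measurable_PiM_coordinate])
      simp
  have eps: "\<epsilon> j \<in> borel_measurable M" if "j \<in> ?J" for j
    using distributed_measurable[OF dist[OF that]] by simp
  have noise: "distr M ?N (\<lambda>\<omega>. \<lambda>j\<in>?J. \<epsilon> j \<omega>) = density ?L \<phi>"
    unfolding \<phi>_def by (rule joint_distr_density[OF M(1) _ M(2) dist]) simp_all
  have R_residual: "R (residual ?J x) = x" if "x \<in> space ?L" for x
  proof
    fix j
    show "R (residual ?J x) j = x j"
    proof (cases "j \<in> ?J")
      case True
      have "sol (residual ?J x) j = x j"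
      proof (rule solution_unique[OF sol _ True])
        show "x i = \<mu> i + (\<Sum>l\<in>pa E i. f i l (x l)) + residual ?J x i" if "i \<in> ?J" for i
          using that by (simp add: residual_def)
      qed
      then show ?thesis using True by (simp add: R_def)
    qed (use that in \<open>auto simp: R_def space_PiM PiE_def extensional_def\<close>)
  qed
  have density_eq: "\<phi> (residual ?J x) = ennreal (normalizer * exp (- (\<Sum>j\<in>?J. (F x j)\<^sup>2) / 2))" for x
  proof -
    have "\<phi> (residual ?J x) = (\<Prod>j\<in>?J. ennreal (1 / sqrt (2 * pi * (s j)\<^sup>2) * exp (- (F x j)\<^sup>2 / 2)))"
      unfolding \<phi>_def
    proof (intro prod.cong refl arg_cong[where f = ennreal])
      fix j assume j: "j \<in> ?J"
      then have "residual ?J x j = s j * F x j"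
        using s_pos[OF j] by (simp add: residual_def plsem_fun_def)
      then show "normal_density 0 (s j) (residual ?J x j)
          = 1 / sqrt (2 * pi * (s j)\<^sup>2) * exp (- (F x j)\<^sup>2 / 2)"
        using s_pos[OF j] by (simp add: normal_density_def power_mult_distrib)
    qed
    also have "\<dots> = ennreal (\<Prod>j\<in>?J. 1 / sqrt (2 * pi * (s j)\<^sup>2) * exp (- (F x j)\<^sup>2 / 2))"
      by (intro prod_ennreal) simp
    also have "(\<Prod>j\<in>?J. 1 / sqrt (2 * pi * (s j)\<^sup>2) * exp (- (F x j)\<^sup>2 / 2))
        = normalizer * exp (\<Sum>j\<in>?J. - (F x j)\<^sup>2 / 2)"
      by (simp only: prod.distrib normalizer_def exp_sum finite_atLeastAtMost)
    finally show ?thesis by (simp add: sum_negf sum_divide_distrib)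
  qed
  have "distr M ?N (\<lambda>\<omega>. restrict (X \<omega>) ?J) = distr M ?N (\<lambda>\<omega>. R (\<lambda>j\<in>?J. \<epsilon> j \<omega>))"
  proof (intro distr_cong refl ext)
    fix \<omega> j assume \<omega>: "\<omega> \<in> space M"
    have "X \<omega> j = sol (\<lambda>j\<in>?J. \<epsilon> j \<omega>) j" if j: "j \<in> ?J"
    proof (rule solution_unique[OF _ sol j])
      show "X \<omega> i = \<mu> i + (\<Sum>l\<in>pa E i. f i l (X \<omega> l)) + (\<lambda>j\<in>?J. \<epsilon> j \<omega>) i" if "i \<in> ?J" for i
        using X[OF \<omega> that] that by simp
    qed
    then show "restrict (X \<omega>) ?J j = R (\<lambda>j\<in>?J. \<epsilon> j \<omega>) j"
      by (simp add: R_def)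
  qed
  also have "\<dots> = distr (distr M ?L (\<lambda>\<omega>. \<lambda>j\<in>?J. \<epsilon> j \<omega>)) ?N R"
    by (subst distr_distr) (auto intro!: R measurable_restrict eps simp: o_def)
  also have "distr M ?L (\<lambda>\<omega>. \<lambda>j\<in>?J. \<epsilon> j \<omega>) = density ?L \<phi>"
    unfolding noise[symmetric] by (intro distr_cong sets_L) auto
  also have "distr (density ?L \<phi>) ?N R = density ?L (\<lambda>x. \<phi> (residual ?J x))"
  proof (rule measure_eqI)
    show "sets (distr (density ?L \<phi>) ?N R) = sets (density ?L (\<lambda>x. \<phi> (residual ?J x)))"
      by (simp add: sets_L)
    fix A assume "A \<in> sets (distr (density ?L \<phi>) ?N R)"
    then have A[measurable]: "A \<in> sets ?N" by simp
    then have A'[measurable]: "A \<in> sets ?L" by (simp add: sets_L)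
    note residual_measurable[measurable]
    have "emeasure (distr (density ?L \<phi>) ?N R) A = (\<integral>\<^sup>+ y. \<phi> y * indicator A (R y) \<partial>?L)"
      by (subst emeasure_distr)
        (auto simp: emeasure_density intro!: nn_integral_cong split: split_indicator)
    also have "\<dots> = (\<integral>\<^sup>+ x. \<phi> (residual ?J x) * indicator A (R (residual ?J x)) \<partial>?L)"
      by (rule residual_preserves_lborel[symmetric]) simp_all
    also have "\<dots> = (\<integral>\<^sup>+ x. \<phi> (residual ?J x) * indicator A x \<partial>?L)"
      by (intro nn_integral_cong) (simp add: R_residual)
    also have "\<dots> = emeasure (density ?L (\<lambda>x. \<phi> (residual ?J x))) A"
      by (rule emeasure_density[symmetric]) measurable
    finally show "emeasure (distr (density ?L \<phi>) ?N R) A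
        = emeasure (density ?L (\<lambda>x. \<phi> (residual ?J x))) A" .
  qed
  finally show ?thesis by (simp only: density_eq)
qed

end

section \<open>Equal laws and admissible orders\<close>

lemma sum_fun_apply: "(\<Sum>i\<in>S. g i) x = (\<Sum>i\<in>S. g i x)"
  by (induction S rule: infinite_finite_induct) auto

text \<open>Turns the abstract functionals produced by the inductions into rows of a matrix, whose
  entries are the values at standard basis vectors.\<close>

lemma linear_on_finite_support:
  fixes L :: "('i \<Rightarrow> real) \<Rightarrow> real"
  assumes "linear L" "finite J"
  shows "L (\<lambda>j. if j \<in> J then y j else 0) = (\<Sum>j\<in>J. y j * L (\<lambda>i. if i = j then 1 else 0))"
proof -
  have "(\<lambda>j. if j \<in> J then y j else 0) = (\<Sum>j\<in>J. y j *\<^sub>R (\<lambda>i. if i = j then 1 else 0))"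
  proof
    fix i
    have "(\<Sum>j\<in>J. y j *\<^sub>R (if i = j then 1 else 0)) = (if i \<in> J then y i else 0)"
      using \<open>finite J\<close> by (simp add: if_distrib[of "\<lambda>z. _ * z"] cong: if_cong)
    then show "(if i \<in> J then y i else 0) = (\<Sum>j\<in>J. y j *\<^sub>R (\<lambda>i. if i = j then 1 else 0)) i"
      by (simp only: sum_fun_apply scaleR_fun_apply)
  qed
  then show ?thesis
    by (simp add: linear_sum[OF \<open>linear L\<close>] linear_cmul[OF \<open>linear L\<close>])
qed

lemma bilinear_coordinate_product:
  "bilinear (\<lambda>u w :: 'i \<Rightarrow> real. \<Sum>j\<in>J. u j * w j)"
  unfolding bilinear_def
  by (auto intro!: linearI simp: algebra_simps sum.distrib sum_distrib_left)

text \<open>Continuous functions that differ at a point differ on an open box, which has positive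
  measure. The topology concerns all coordinates but the measure only those in J;
  \<open>local\<close> bridges the gap.\<close>

lemma AE_PiM_lborel_continuous_eq:
  fixes g h :: "('i \<Rightarrow> real) \<Rightarrow> real"
  assumes "finite J" and cont: "continuous_on UNIV g" "continuous_on UNIV h"
    and local: "\<And>x y. (\<And>j. j \<in> J \<Longrightarrow> x j = y j) \<Longrightarrow> g x = g y \<and> h x = h y"
    and AE: "AE x in PiM J (\<lambda>_. lborel). g x = h x"
  shows "g x = h x"
proof (rule ccontr)
  interpret L: product_sigma_finite "\<lambda>_. lborel :: real measure"
    by (rule product_sigma_finite_lborel)
  assume neq: "g x \<noteq> h x"
  have "open {x. g x \<noteq> h x}"
    using cont by (rule open_Collect_neq)
  then have "openin (product_topology (\<lambda>_. euclidean) UNIV) {x. g x \<noteq> h x}"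
    by (simp add: open_fun_def)
  from product_topology_open_contains_basis[OF this, of x] neq
  obtain U where U: "x \<in> (\<Pi>\<^sub>E i\<in>UNIV. U i)" "\<And>i. open (U i)" "(\<Pi>\<^sub>E i\<in>UNIV. U i) \<subseteq> {x. g x \<noteq> h x}"
    by auto
  have "emeasure (PiM J (\<lambda>_. lborel)) (Pi\<^sub>E J U) = (\<Prod>j\<in>J. emeasure lborel (U j))"
    using U(2) \<open>finite J\<close> by (intro L.emeasure_PiM) auto
  moreover have "emeasure lborel (U j) \<noteq> 0" for j
  proof -
    have "x j \<in> U j" using U(1) by auto
    then obtain e where "e > 0" "ball (x j) e \<subseteq> U j"
      using U(2)[of j] open_contains_ball by blast
    then have "emeasure lborel {x j - e<..<x j + e} \<le> emeasure lborel (U j)"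
      using U(2)[of j] by (intro emeasure_mono) (auto simp: ball_eq_greaterThanLessThan)
    then show ?thesis using \<open>e > 0\<close> by auto
  qed
  ultimately have pos: "emeasure (PiM J (\<lambda>_. lborel)) (Pi\<^sub>E J U) \<noteq> 0"
    using \<open>finite J\<close> by simp
  obtain N where N: "N \<in> null_sets (PiM J (\<lambda>_. lborel))"
    "{y \<in> space (PiM J (\<lambda>_. lborel)). g y \<noteq> h y} \<subseteq> N"
    using AE_E2[OF AE] AE unfolding eventually_ae_filter by blast
  have "g y \<noteq> h y" if "y \<in> Pi\<^sub>E J U" for y
  proof -
    \<comment> \<open>Coordinates outside J are borrowed from x, which puts \<open>y'\<close> into
      the box over all indices.\<close>
    define y' where "y' i = (if i \<in> J then y i else x i)" for i
    have "y' \<in> (\<Pi>\<^sub>E i\<in>UNIV. U i)" using that U(1) by (auto simp: y'_def PiE_iff)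
    then have "g y' \<noteq> h y'" using U(3) by blast
    moreover have "g y' = g y \<and> h y' = h y" by (rule local) (simp add: y'_def)
    ultimately show ?thesis by simp
  qed
  then have "Pi\<^sub>E J U \<subseteq> N" using N(2) by (auto simp: space_PiM PiE_def)
  then have "emeasure (PiM J (\<lambda>_. lborel)) (Pi\<^sub>E J U) \<le> emeasure (PiM J (\<lambda>_. lborel)) N"
    using N(1) by (intro emeasure_mono) auto
  then show False using pos N(1) by auto
qed

text \<open>The number of strict ancestors grows along an edge from i to j: i is an ancestor of j
  but, by acyclicity, not of itself.\<close>

lemma ex_rank_of_acyclic:
  assumes "finite E" "acyclic E"
  shows "\<exists>c :: 'a \<Rightarrow> nat. \<forall>(i, j)\<in>E. c i < c j"
proof -
  define c where "c j = card {l. (l, j) \<in> E\<^sup>+}" for j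
  have "c i < c j" if "(i, j) \<in> E" for i j
    unfolding c_def
  proof (rule psubset_card_mono)
    have "finite (E\<^sup>+)" using \<open>finite E\<close> by (simp add: finite_trancl)
    then show "finite {l. (l, j) \<in> E\<^sup>+}"
      by (rule finite_subset[OF _ finite_imageI[of _ fst], rotated]) force
    show "{l. (l, i) \<in> E\<^sup>+} \<subset> {l. (l, j) \<in> E\<^sup>+}"
      using that \<open>acyclic E\<close> by (auto simp: acyclic_def intro: trancl_into_trancl)
  qed
  then show ?thesis by blast
qed

section \<open>Pointwise comparison of two densities\<close>

context additive_model
begin

lemma F_continuous: "continuous_on UNIV (\<lambda>x. F x j)" if "j \<in> {1..p}"
  unfolding plsem_fun_def using s_pos[OF that]
  by (intro continuous_intros continuous_on_compose2[OF C2_continuous[OF pa_C2]]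
      continuous_on_product_coordinates) auto

lemma F_measurable [measurable]:
  "(\<lambda>x. F x j) \<in> borel_measurable (PiM S (\<lambda>_. lborel))"
  unfolding plsem_fun_def
  by (intro borel_measurable_diff borel_measurable_divide borel_measurable_sum
      borel_measurable_const borel_measurable_PiM_coordinate
      measurable_compose[OF borel_measurable_PiM_coordinate f_measurable])

lemma F_local:
  assumes "\<And>i. i \<in> {1..p} \<Longrightarrow> x i = y i" "j \<in> {1..p}"
  shows "F x j = F y j"
proof -
  have "(\<Sum>i\<in>pa E j. f j i (x i)) = (\<Sum>i\<in>pa E j. f j i (y i))"
    using assms(1) pa_subset[of j] by (intro sum.cong) auto
  then show ?thesis using assms by (simp add: plsem_fun_def)
qed

end

text \<open>Continuity upgrades equality almost everywhere to all x. The constants are matched at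
  zeros of the two maps: at a zero of the first, the first density is K and the second at most K',
  and vice versa.\<close>

lemma squares_eq_of_density_eq:
  assumes "additive_model p E f s c" "additive_model p E' f' s' c'"
    and pos: "K > 0" "K' > 0"
    and eq: "density (PiM {1..p} (\<lambda>_. lborel))
        (\<lambda>x. ennreal (K * exp (- (\<Sum>j\<in>{1..p}. (plsem_fun E \<mu> f s x j)\<^sup>2) / 2)))
      = density (PiM {1..p} (\<lambda>_. lborel))
        (\<lambda>x. ennreal (K' * exp (- (\<Sum>j\<in>{1..p}. (plsem_fun E' \<mu>' f' s' x j)\<^sup>2) / 2)))"
  shows "(\<Sum>j\<in>{1..p}. (plsem_fun E \<mu> f s x j)\<^sup>2) = (\<Sum>j\<in>{1..p}. (plsem_fun E' \<mu>' f' s' x j)\<^sup>2)"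
proof -
  interpret F: additive_model p E \<mu> f s c by fact
  interpret G: additive_model p E' \<mu>' f' s' c' by fact
  let ?L = "PiM {1..p} (\<lambda>_. lborel :: real measure)"
  define q where "q x = (\<Sum>j\<in>{1..p}. (F.F x j)\<^sup>2)" for x
  define r where "r x = (\<Sum>j\<in>{1..p}. (G.F x j)\<^sup>2)" for x
  interpret L: product_sigma_finite "\<lambda>_::nat. lborel :: real measure"
    by (rule product_sigma_finite_lborel)
  interpret LJ: sigma_finite_measure ?L by (rule L.sigma_finite) simp
  have q: "continuous_on UNIV (\<lambda>x. K * exp (- q x / 2))"
    unfolding q_def by (intro continuous_intros F.F_continuous) auto
  have r: "continuous_on UNIV (\<lambda>x. K' * exp (- r x / 2))"
    unfolding r_def by (intro continuous_intros G.F_continuous) auto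
  have "AE x in ?L. ennreal (K * exp (- q x / 2)) = ennreal (K' * exp (- r x / 2))"
    using eq unfolding q_def[symmetric] r_def[symmetric]
    by (subst (asm) LJ.density_unique_iff) (simp_all add: q_def r_def)
  then have AE: "AE x in ?L. K * exp (- q x / 2) = K' * exp (- r x / 2)"
    using pos by auto
  have pointwise: "K * exp (- q x / 2) = K' * exp (- r x / 2)" for x
  proof (rule AE_PiM_lborel_continuous_eq[OF _ q r _ AE])
    show "K * exp (- q x / 2) = K * exp (- q y / 2) \<and> K' * exp (- r x / 2) = K' * exp (- r y / 2)"
      if "\<And>j. j \<in> {1..p} \<Longrightarrow> x j = y j" for x y
      using F.F_local[OF that] G.F_local[OF that] by (simp add: q_def r_def)
  qed simp
  have nonneg: "q x \<ge> 0" "r x \<ge> 0" for x by (simp_all add: q_def r_def sum_nonneg)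
  obtain x0 where "\<forall>k\<in>{1..p}. F.F x0 k = 0" using F.F_surj[of "\<lambda>_. 0"] by blast
  then have "q x0 = 0" by (simp add: q_def)
  then have "K = K' * exp (- r x0 / 2)" using pointwise[of x0] by simp
  also have "\<dots> \<le> K'" using pos nonneg(2)[of x0] by (simp add: mult_le_cancel_left1)
  finally have "K \<le> K'" .
  obtain x1 where "\<forall>k\<in>{1..p}. G.F x1 k = 0" using G.F_surj[of "\<lambda>_. 0"] by blast
  then have "r x1 = 0" by (simp add: r_def)
  then have "K' = K * exp (- q x1 / 2)" using pointwise[of x1] by simp
  also have "\<dots> \<le> K" using pos nonneg(1)[of x1] by (simp add: mult_le_cancel_left1)
  finally have "K = K'" using \<open>K \<le> K'\<close> by simp
  then have "q x = r x" using pointwise[of x] pos by simp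
  then show ?thesis by (simp add: q_def r_def)
qed

text \<open>Any rank compatible with the edges will do, in particular the permutation whose
  membership in \<open>S_perms\<close> is at stake.\<close>

lemma plsem_generates_model:
  assumes "plsem_generates p E \<mu> f s P" and "\<And>i j. (i, j) \<in> E \<Longrightarrow> c i < c j"
  shows "additive_model p E f s c"
  using assms unfolding plsem_generates_def is_dag_def by unfold_locales auto

lemma plsem_generates_ex_model:
  assumes gen: "plsem_generates p E \<mu> f s P"
  shows "\<exists>c. additive_model p E f s c"
proof -
  have "is_dag p E" using gen by (simp add: plsem_generates_def)
  then have "acyclic E" "finite E" by (auto simp: is_dag_def intro: finite_subset)
  then obtain c :: "nat \<Rightarrow> nat" where "\<And>i j. (i, j) \<in> E \<Longrightarrow> c i < c j"
    using ex_rank_of_acyclic[of E] by blast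
  then show ?thesis using plsem_generates_model[OF gen] by blast
qed

lemma plsem_generatesE:
  assumes "plsem_generates p E \<mu> f s P"
  obtains M :: "(nat \<Rightarrow> real) measure" and \<epsilon> X where
    "prob_space M" "prob_space.indep_vars M (\<lambda>_. borel) \<epsilon> {1..p}"
    "\<And>j. j \<in> {1..p} \<Longrightarrow> distributed M lborel (\<epsilon> j) (\<lambda>x. ennreal (normal_density 0 (s j) x))"
    "\<And>j. j \<in> {1..p} \<Longrightarrow> (\<lambda>\<omega>. X \<omega> j) \<in> borel_measurable M"
    "\<And>\<omega> j. \<omega> \<in> space M \<Longrightarrow> j \<in> {1..p} \<Longrightarrow>
       X \<omega> j = \<mu> j + (\<Sum>i\<in>pa E j. f j i (X \<omega> i)) + \<epsilon> j \<omega>"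
    "\<And>i j. (i, j) \<in> E \<Longrightarrow> integrable M (\<lambda>\<omega>. f j i (X \<omega> i))"
    "P = distr M (PiM {1..p} (\<lambda>_. borel)) (\<lambda>\<omega>. restrict (X \<omega>) {1..p})"
proof -
  obtain M :: "(nat \<Rightarrow> real) measure" and \<epsilon> X where
    "prob_space M \<and>
        prob_space.indep_vars M (\<lambda>_. borel) \<epsilon> {1..p} \<and>
        (\<forall>j\<in>{1..p}. distributed M lborel (\<epsilon> j) (\<lambda>x. ennreal (normal_density 0 (s j) x))) \<and>
        (\<forall>j\<in>{1..p}. (\<lambda>\<omega>. X \<omega> j) \<in> borel_measurable M) \<and>
        (\<forall>\<omega>\<in>space M. \<forall>j\<in>{1..p}.
            X \<omega> j = \<mu> j + (\<Sum>i\<in>pa E j. f j i (X \<omega> i)) + \<epsilon> j \<omega>) \<and>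
        (\<forall>(i, j)\<in>E. integrable M (\<lambda>\<omega>. f j i (X \<omega> i)) \<and>
                     (\<integral>\<omega>. f j i (X \<omega> i) \<partial>M) = 0) \<and>
        P = distr M (PiM {1..p} (\<lambda>_. borel)) (\<lambda>\<omega>. restrict (X \<omega>) {1..p})"
    using assms unfolding plsem_generates_def by (elim conjE exE) blast
  then show thesis by (intro that[of M \<epsilon> X]) blast+
qed

lemma plsem_generates_density:
  assumes gen: "plsem_generates p E \<mu> f s P" and model: "additive_model p E f s c"
  shows "P = density (PiM {1..p} (\<lambda>_. lborel))
      (\<lambda>x. ennreal (additive_model.normalizer p s * exp (- (\<Sum>j\<in>{1..p}. (plsem_fun E \<mu> f s x j)\<^sup>2) / 2)))"
proof -
  interpret additive_model p E \<mu> f s c by fact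
  from gen show ?thesis
  proof (rule plsem_generatesE)
    fix M :: "(nat \<Rightarrow> real) measure" and \<epsilon> X
    assume *: "prob_space M" "prob_space.indep_vars M (\<lambda>_. borel) \<epsilon> {1..p}"
      "\<And>j. j \<in> {1..p} \<Longrightarrow> distributed M lborel (\<epsilon> j) (\<lambda>x. ennreal (normal_density 0 (s j) x))"
      "\<And>\<omega> j. \<omega> \<in> space M \<Longrightarrow> j \<in> {1..p} \<Longrightarrow>
         X \<omega> j = \<mu> j + (\<Sum>i\<in>pa E j. f j i (X \<omega> i)) + \<epsilon> j \<omega>"
      and P: "P = distr M (PiM {1..p} (\<lambda>_. borel)) (\<lambda>\<omega>. restrict (X \<omega>) {1..p})"
    show ?thesis
      unfolding P by (rule law_density[OF *])
  qed
qed

section \<open>Two models of one law: the order respects V\<close>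

lemma plsem_fun_orthogonal_relation:
  assumes "additive_model p E f s c" "additive_model p E' f' s' c'"
    and sq: "\<And>x. (\<Sum>j\<in>{1..p}. (plsem_fun E \<mu> f s x j)\<^sup>2)
      = (\<Sum>j\<in>{1..p}. (plsem_fun E' \<mu>' f' s' x j)\<^sup>2)"
  obtains Q where "\<And>x k. k \<in> {1..p} \<Longrightarrow>
    plsem_fun E' \<mu>' f' s' x k = (\<Sum>j\<in>{1..p}. Q k j * plsem_fun E \<mu> f s x j)"
proof -
  interpret F: additive_model p E \<mu> f s c by fact
  interpret G: additive_model p E' \<mu>' f' s' c' by fact
  let ?J = "{1..p}"
  \<comment> \<open>F is cut off outside 1..p so that a linear functional of \<open>V x\<close> is
    determined by its values at p basis vectors.\<close>
  define V where "V x = (\<lambda>j. if j \<in> ?J then F.F x j else 0)" for x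
  define B where "B u w = (\<Sum>j\<in>?J. u j * w j)" for u w :: "nat \<Rightarrow> real"
  have "\<forall>k\<in>?J. \<exists>L. linear L \<and> (\<forall>x. G.F x k = L (V x))"
  proof (rule linear_of_square_sum[where G = "\<lambda>k x. G.F x k" and c = c' and B = B
        and a = "\<lambda>k. 1 / s' k"])
    show "V (x(k := t)) - V (x(k := u)) = V (x'(k := t)) - V (x'(k := u))" for k x x' t u
      using F.F_upd[of x k t _ u] F.F_upd[of x' k t _ u] by (auto simp: V_def fun_eq_iff)
    show "G.F (x(k := t)) k = G.F (x(k := u)) k + 1 / s' k * (t - u)" for k x t u
      using G.F_upd[of x k t k u] by (simp add: G.H_def diff_divide_distrib)
    show "1 / s' k \<noteq> 0" if "k \<in> ?J" for k using G.s_pos[OF that] by simp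
    show "G.F (x(k := t)) l = G.F x l" if "l \<noteq> k" "c' l \<le> c' k" for k l x t
      using G.F_upd[of x k t l "x k"] that G.pa_rank[of k l] by (auto simp: G.H_def)
    show "bilinear B" unfolding B_def[abs_def] by (rule bilinear_coordinate_product)
    show "B u w = B w u" for u w by (simp add: B_def mult.commute)
    show "continuous_on UNIV (\<lambda>t. B (V (x(k := t))) m)" for m k x
    proof -
      have "continuous_on UNIV (\<lambda>t. F.F (x(k := t)) j)" for j
        using F.F_has_partial DERIV_continuous_on by blast
      then have "continuous_on UNIV (\<lambda>t. \<Sum>j\<in>?J. F.F (x(k := t)) j * m j)"
        by (intro continuous_intros)
      moreover have "B (V y) m = (\<Sum>j\<in>?J. F.F y j * m j)" for y
        unfolding B_def V_def by (intro sum.cong) auto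
      ultimately show ?thesis by simp
    qed
    show "\<exists>x. \<forall>z. B y z = B (V x) z" for y
    proof -
      obtain x where "\<forall>k\<in>?J. F.F x k = y k" using F.F_surj by blast
      then have "B y z = B (V x) z" for z
        unfolding B_def V_def by (intro sum.cong) auto
      then show ?thesis by blast
    qed
    have "B (V x) (V x) = (\<Sum>j\<in>?J. (F.F x j)\<^sup>2)" for x
      unfolding B_def V_def power2_eq_square by (intro sum.cong) auto
    then show "B (V x) (V x) = (\<Sum>k\<in>?J. (G.F x k)\<^sup>2)" for x by (simp add: sq)
  qed simp
  then obtain L where L: "\<And>k. k \<in> ?J \<Longrightarrow> linear (L k)"
    "\<And>k x. k \<in> ?J \<Longrightarrow> G.F x k = L k (V x)" by metis
  show thesis
  proof (rule that)
    show "G.F x k = (\<Sum>j\<in>?J. L k (\<lambda>i. if i = j then 1 else 0) * F.F x j)" if "k \<in> ?J" for x k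
      using linear_on_finite_support[OF L(1)[OF that], of ?J "F.F x"] L(2)[OF that]
      by (simp add: V_def mult.commute)
  qed
qed

text \<open>Q is constant, so it also relates the first and second derivatives. A solution v of the
  F-system for the second derivative in x_i thus solves the G-system, whose right-hand side vanishes
  on ranks up to \<open>c' i\<close>; forward substitution makes v vanish there.\<close>

lemma V_set_respects_order:
  assumes "additive_model p E f s c" "additive_model p E' f' s' c'"
    and Q: "\<And>x k. k \<in> {1..p} \<Longrightarrow>
      plsem_fun E' \<mu>' f' s' x k = (\<Sum>j\<in>{1..p}. Q k j * plsem_fun E \<mu> f s x j)"
    and V: "(i, j) \<in> V_set p (plsem_fun E \<mu> f s)"
  shows "c' i < c' j"
proof (rule ccontr)
  interpret F: additive_model p E \<mu> f s c by fact
  interpret G: additive_model p E' \<mu>' f' s' c' by fact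
  let ?J = "{1..p}"
  assume "\<not> c' i < c' j"
  obtain x v where ij: "i \<in> ?J" "j \<in> ?J"
    and v: "\<And>k. k \<in> ?J \<Longrightarrow> (\<Sum>l\<in>?J. F.D1 k l (x l) * v l) = F.D2 k i (x i)" and "v j \<noteq> 0"
    using V unfolding F.V_set_F by blast
  \<comment> \<open>Moving one coordinate away from 0 in G = QF isolates the summands, up to
    constants.\<close>
  have H: "G.H k l t = G.H k l 0 + (\<Sum>j\<in>?J. Q k j * (F.H j l t - F.H j l 0))"
    if "k \<in> ?J" for k l t
  proof -
    have "G.H k l t - G.H k l 0 = G.F ((\<lambda>_. 0)(l := t)) k - G.F ((\<lambda>_. 0)(l := 0)) k"
      using G.F_upd[of _ l t k 0] by simp
    also have "\<dots> = (\<Sum>j\<in>?J. Q k j * (F.F ((\<lambda>_. 0)(l := t)) j - F.F ((\<lambda>_. 0)(l := 0)) j))"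
      by (simp only: Q[OF that] right_diff_distrib sum_subtractf)
    also have "\<dots> = (\<Sum>j\<in>?J. Q k j * (F.H j l t - F.H j l 0))"
      using F.F_upd[of _ l t _ 0] by simp
    finally show ?thesis by simp
  qed
  have D1: "G.D1 k l = (\<lambda>t. \<Sum>j\<in>?J. Q k j * F.D1 j l t)" if "k \<in> ?J" for k l
  proof
    fix t
    have "((\<lambda>t. G.H k l 0 + (\<Sum>j\<in>?J. Q k j * (F.H j l t - F.H j l 0)))
        has_real_derivative (\<Sum>j\<in>?J. Q k j * F.D1 j l t)) (at t)"
      by (auto intro!: derivative_eq_intros F.H_deriv simp: mult.commute)
    moreover have "G.H k l = (\<lambda>t. G.H k l 0 + (\<Sum>j\<in>?J. Q k j * (F.H j l t - F.H j l 0)))"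
      using H[OF that] by blast
    ultimately show "G.D1 k l t = (\<Sum>j\<in>?J. Q k j * F.D1 j l t)"
      using DERIV_unique[OF G.H_deriv] by metis
  qed
  have D2: "G.D2 k l t = (\<Sum>j\<in>?J. Q k j * F.D2 j l t)" if "k \<in> ?J" for k l t
  proof -
    have "((\<lambda>t. \<Sum>j\<in>?J. Q k j * F.D1 j l t)
        has_real_derivative (\<Sum>j\<in>?J. Q k j * F.D2 j l t)) (at t)"
      by (auto intro!: derivative_eq_intros F.D1_deriv simp: mult.commute)
    then show ?thesis
      using DERIV_unique[OF G.D1_deriv] D1[OF that] by metis
  qed
  have "(\<Sum>l\<in>?J. G.D1 k l (x l) * v l) = G.D2 k i (x i)" if "k \<in> ?J" for k
  proof -
    have "(\<Sum>l\<in>?J. G.D1 k l (x l) * v l) = (\<Sum>l\<in>?J. \<Sum>j\<in>?J. Q k j * (F.D1 j l (x l) * v l))"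
      by (simp add: D1[OF that] sum_distrib_right mult.assoc)
    also have "\<dots> = (\<Sum>j\<in>?J. \<Sum>l\<in>?J. Q k j * (F.D1 j l (x l) * v l))" by (rule sum.swap)
    also have "\<dots> = G.D2 k i (x i)"
      by (simp add: D2[OF that] sum_distrib_left[symmetric] v)
    finally show ?thesis .
  qed
  moreover have "G.D2 k i (x i) = 0" if "c' k \<le> c' i" for k
    using that G.pa_rank[of i k] by (auto simp: G.D2_def)
  ultimately have "v j = 0"
    using \<open>\<not> c' i < c' j\<close> ij by (intro G.forward_substitution[of "c' i" x v j]) auto
  then show False using \<open>v j \<noteq> 0\<close> by simp
qed

lemma S_perms_respects_V_set:
  assumes gen: "plsem_generates p E \<mu> f s P" and "\<sigma> \<in> S_perms p P"
    and V: "(i, j) \<in> V_set p (plsem_fun E \<mu> f s)"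
  shows "\<sigma> i < \<sigma> j"
proof -
  obtain c where model: "additive_model p E f s c"
    using plsem_generates_ex_model[OF gen] by blast
  obtain E' \<mu>' f' s' where gen': "plsem_generates p E' \<mu>' f' s' P"
    and "\<And>i j. (i, j) \<in> E' \<Longrightarrow> \<sigma> i < \<sigma> j"
    using \<open>\<sigma> \<in> S_perms p P\<close> unfolding S_perms_def by blast
  then have model': "additive_model p E' f' s' \<sigma>" by (intro plsem_generates_model)
  have "(\<Sum>j\<in>{1..p}. (plsem_fun E \<mu> f s x j)\<^sup>2) = (\<Sum>j\<in>{1..p}. (plsem_fun E' \<mu>' f' s' x j)\<^sup>2)" for x
    by (rule squares_eq_of_density_eq[OF model model' additive_model.normalizer_pos[OF model]
          additive_model.normalizer_pos[OF model'] trans[OF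
          plsem_generates_density[OF gen model, symmetric] plsem_generates_density[OF gen' model']]])
  then show ?thesis
  proof (rule plsem_fun_orthogonal_relation[OF model model'])
    fix Q assume "\<And>x k. k \<in> {1..p} \<Longrightarrow>
      plsem_fun E' \<mu>' f' s' x k = (\<Sum>j\<in>{1..p}. Q k j * plsem_fun E \<mu> f s x j)"
    then show ?thesis by (rule V_set_respects_order[OF model model' _ V])
  qed
qed

section \<open>A triangular form for every order respecting V\<close>

lemma (in additive_model) triangular_representation:
  assumes V: "\<And>i j. (i, j) \<in> V_set p F \<Longrightarrow> \<sigma> i < (\<sigma> j :: nat)"
  obtains Q a where
    "\<And>k. k \<in> {1..p} \<Longrightarrow> a k > 0"
    "\<And>k l t. k \<in> {1..p} \<Longrightarrow> l \<in> {1..p} \<Longrightarrow> \<sigma> k < \<sigma> l \<Longrightarrow>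
      (\<Sum>j\<in>{1..p}. Q k j * H j l t) = (\<Sum>j\<in>{1..p}. Q k j * H j l 0)"
    "\<And>k t. k \<in> {1..p} \<Longrightarrow>
      (\<Sum>j\<in>{1..p}. Q k j * H j k t) = a k * t + (\<Sum>j\<in>{1..p}. Q k j * H j k 0)"
    "\<And>x. (\<Sum>k\<in>{1..p}. (\<Sum>j\<in>{1..p}. Q k j * F x j)\<^sup>2) = (\<Sum>j\<in>{1..p}. (F x j)\<^sup>2)"
proof -
  let ?J = "{1..p}"
  define e where "e j = (\<lambda>i :: nat. if i = j then 1 else 0 :: real)" for j
  \<comment> \<open>\<open>v l t\<close> is column l of DF at x_l = t, cut off outside 1..p.
    \<open>Z\<close> below is the kernel of the Euclidean product B on these coordinates.\<close>
  define v where "v l t = (\<lambda>j. if j \<in> ?J then D1 j l t else 0)" for l t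
  define Z where "Z = {y :: nat \<Rightarrow> real. \<forall>j\<in>?J. y j = 0}"
  define B where "B u w = (\<Sum>j\<in>?J. u j * w j)" for u w :: "nat \<Rightarrow> real"
  have \<phi>_v: "\<phi> (v l t) = (\<Sum>j\<in>?J. D1 j l t * \<phi> (e j))"
    if "linear \<phi>" for \<phi> :: "(nat \<Rightarrow> real) \<Rightarrow> real" and l t
    unfolding v_def e_def by (rule linear_on_finite_support[OF that]) simp
  have B_self: "B y y = 0 \<Longrightarrow> y \<in> Z" for y
    by (simp add: B_def Z_def sum_nonneg_eq_0_iff)
  have "\<exists>L. (\<forall>k\<in>?J. linear (L k)
      \<and> (\<forall>l\<in>?J. \<forall>t. \<sigma> k < \<sigma> l \<longrightarrow> L k (v l t) = 0) \<and> (\<exists>a>0. \<forall>t. L k (v k t) = a))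
      \<and> (\<forall>y. B y y = (\<Sum>k\<in>?J. (L k y :: real)\<^sup>2))"
  proof (rule triangular_squares[where Z = Z and B = B])
    fix \<phi> :: "(nat \<Rightarrow> real) \<Rightarrow> real" and k t
    assume \<phi>: "linear \<phi>" and k: "k \<in> ?J"
      and later: "\<And>l s. l \<in> ?J \<Longrightarrow> \<sigma> k < \<sigma> l \<Longrightarrow> \<phi> (v l s) = 0"
    \<comment> \<open>By V, the second derivative of F in x_k is a combination of later columns. A
      functional that kills those has derivative zero along column k.\<close>
    have "((\<lambda>t. \<Sum>j\<in>?J. D1 j k t * \<phi> (e j)) has_real_derivative 0) (at t)" for t
    proof -
      \<comment> \<open>Evaluation at the constant point (t, ..., t): each column depends on its own
        coordinate only, and the later ones are killed at every parameter.\<close>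
      obtain w where w: "\<And>j. j \<in> ?J \<Longrightarrow> (\<Sum>l\<in>?J. D1 j l t * w l) = D2 j k t"
        using D1_solvable[of "\<lambda>_. t" "\<lambda>j. D2 j k t"] by blast
      have "(\<Sum>j\<in>?J. D2 j k t * \<phi> (e j)) = (\<Sum>j\<in>?J. \<Sum>l\<in>?J. w l * (D1 j l t * \<phi> (e j)))"
        by (simp add: w[symmetric] sum_distrib_right sum_distrib_left mult_ac)
      also have "\<dots> = (\<Sum>l\<in>?J. w l * \<phi> (v l t))"
        by (subst sum.swap) (simp add: \<phi>_v[OF \<phi>] sum_distrib_left)
      also have "\<dots> = 0"
      proof (intro sum.neutral ballI)
        fix l assume l: "l \<in> ?J"
        have "(k, l) \<in> V_set p F" if "w l \<noteq> 0"
          unfolding V_set_F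
          by (intro conjI exI[of _ "\<lambda>_. t"] exI[of _ w] ballI k l w that)
        then show "w l * \<phi> (v l t) = 0" using V later l by auto
      qed
      finally have "(\<Sum>j\<in>?J. D2 j k t * \<phi> (e j)) = 0" .
      moreover have "((\<lambda>t. \<Sum>j\<in>?J. D1 j k t * \<phi> (e j)) has_real_derivative
          (\<Sum>j\<in>?J. D2 j k t * \<phi> (e j))) (at t)"
        by (intro DERIV_sum DERIV_cmult_right D1_deriv)
      ultimately show ?thesis by simp
    qed
    then show "\<phi> (v k t) = \<phi> (v k 0)"
      unfolding \<phi>_v[OF \<phi>] by (intro DERIV_isconst_all[of "\<lambda>t. \<Sum>j\<in>?J. D1 j k t * \<phi> (e j)"] allI)
  next
    fix k assume k: "k \<in> ?J"
    show "v k 0 \<notin> span (Z \<union> (\<lambda>l. v l 0) ` (?J - {k}))"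
    proof
      let ?S = "{y :: nat \<Rightarrow> real. \<exists>d. \<forall>j\<in>?J. y j = (\<Sum>l\<in>?J - {k}. D1 j l 0 * d l)}"
      assume "v k 0 \<in> span (Z \<union> (\<lambda>l. v l 0) ` (?J - {k}))"
      also have "\<dots> \<subseteq> ?S"
      proof (rule span_minimal)
        show "Z \<union> (\<lambda>l. v l 0) ` (?J - {k}) \<subseteq> ?S"
        proof (intro Un_least subsetI)
          fix y assume "y \<in> Z"
          then show "y \<in> ?S" by (intro CollectI exI[of _ "\<lambda>_. 0"]) (simp add: Z_def)
        next
          fix y assume "y \<in> (\<lambda>l. v l 0) ` (?J - {k})"
          then obtain i where i: "i \<in> ?J - {k}" "y = v i 0" by blast
          have "(\<Sum>l\<in>?J - {k}. D1 j l 0 * (if l = i then 1 else 0)) = D1 j i 0" for j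
            using i(1) by (simp add: if_distrib[of "\<lambda>z. _ * z"] cong: if_cong)
          then show "y \<in> ?S"
            by (intro CollectI exI[of _ "\<lambda>l. if l = i then 1 else 0"]) (simp add: i(2) v_def)
        qed
        show "subspace ?S"
        proof (rule subspaceI)
          show "0 \<in> ?S" by (intro CollectI exI[of _ "\<lambda>_. 0"]) simp
        next
          fix y z assume "y \<in> ?S" "z \<in> ?S"
          then obtain d d' where
            "\<forall>j\<in>?J. y j = (\<Sum>l\<in>?J - {k}. D1 j l 0 * d l)"
            "\<forall>j\<in>?J. z j = (\<Sum>l\<in>?J - {k}. D1 j l 0 * d' l)" by blast
          then show "y + z \<in> ?S"
            by (intro CollectI exI[of _ "\<lambda>l. d l + d' l"]) (simp add: distrib_left sum.distrib)
        next
          fix r :: real and y assume "y \<in> ?S"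
          then obtain d where "\<forall>j\<in>?J. y j = (\<Sum>l\<in>?J - {k}. D1 j l 0 * d l)" by blast
          then show "r *\<^sub>R y \<in> ?S"
            by (intro CollectI exI[of _ "\<lambda>l. r * d l"])
              (simp add: sum_distrib_left mult.left_commute)
        qed
      qed
      finally obtain d where d: "\<And>j. j \<in> ?J \<Longrightarrow> D1 j k 0 = (\<Sum>l\<in>?J - {k}. D1 j l 0 * d l)"
        by (auto simp: v_def)
      \<comment> \<open>A linear dependence becomes a kernel vector of the Jacobian with entry 1 at
        k, against injectivity.\<close>
      define w where "w = (\<lambda>l. - d l)(k := 1)"
      have "(\<Sum>l\<in>?J. D1 j l 0 * w l) = 0" if "j \<in> ?J" for j
      proof -
        have "(\<Sum>l\<in>?J. D1 j l 0 * w l) = D1 j k 0 + (\<Sum>l\<in>?J - {k}. D1 j l 0 * w l)"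
          using k by (subst sum.remove[of _ k]) (auto simp: w_def)
        also have "(\<Sum>l\<in>?J - {k}. D1 j l 0 * w l) = (\<Sum>l\<in>?J - {k}. - (D1 j l 0 * d l))"
          by (intro sum.cong) (auto simp: w_def)
        finally show ?thesis by (simp add: d[OF that] sum_negf)
      qed
      then have "w k = 0" using D1_injective[of "\<lambda>_. 0" w k] k by blast
      then show False by (simp add: w_def)
    qed
  next
    fix y
    obtain w where w: "\<And>j. j \<in> ?J \<Longrightarrow> (\<Sum>l\<in>?J. D1 j l 0 * w l) = y j"
      using D1_solvable[of "\<lambda>_. 0" y] by blast
    define y' where "y' = (\<Sum>l\<in>?J. w l *\<^sub>R v l 0)"
    have "y' j = y j" if "j \<in> ?J" for j
      using w[OF that] that by (simp add: y'_def sum_fun_apply v_def mult.commute)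
    then have "y - y' \<in> Z" by (simp add: Z_def)
    then have "y - y' \<in> span (Z \<union> (\<lambda>l. v l 0) ` ?J)" by (intro span_base) simp
    moreover have "y' \<in> span (Z \<union> (\<lambda>l. v l 0) ` ?J)"
      unfolding y'_def by (intro span_sum span_scale span_base) auto
    ultimately have "(y - y') + y' \<in> span (Z \<union> (\<lambda>l. v l 0) ` ?J)"
      by (rule span_add)
    then show "y \<in> span (Z \<union> (\<lambda>l. v l 0) ` ?J)" by simp
  next
    show "bilinear B" unfolding B_def[abs_def] by (rule bilinear_coordinate_product)
    show "B u w = B w u" for u w by (simp add: B_def mult.commute)
    show "B u u \<ge> 0" for u by (simp add: B_def sum_nonneg)
    show "B y z = 0" if "y \<in> Z" for y z using that by (simp add: B_def Z_def)
    show "y \<in> span (Z \<union> (\<lambda>l. v l 0) ` (?J - ?J))" if "\<And>z. B y z = 0" for y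
      using B_self[OF that] by (intro span_base) auto
  qed auto
  then obtain L where L: "\<And>k. k \<in> ?J \<Longrightarrow> linear (L k)"
    "\<And>k l t. k \<in> ?J \<Longrightarrow> l \<in> ?J \<Longrightarrow> \<sigma> k < \<sigma> l \<Longrightarrow> L k (v l t) = 0"
    "\<And>k. k \<in> ?J \<Longrightarrow> \<exists>a>0. \<forall>t. L k (v k t) = a"
    "\<And>y. B y y = (\<Sum>k\<in>?J. (L k y)\<^sup>2)" by blast
  from L(3) obtain a where a: "\<And>k. k \<in> ?J \<Longrightarrow> a k > 0" "\<And>k t. k \<in> ?J \<Longrightarrow> L k (v k t) = a k"
    by metis
  \<comment> \<open>The derivative of (QF)_k in x_l is then \<open>L k\<close> of column l: zero for
    later l and the constant \<open>a k\<close> for l = k.\<close>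
  define Q where "Q k j = L k (e j)" for k j
  have deriv: "((\<lambda>t. \<Sum>j\<in>?J. Q k j * H j l t) has_real_derivative L k (v l t)) (at t)"
    if "k \<in> ?J" for k l t
    unfolding \<phi>_v[OF L(1)[OF that]] Q_def
    by (auto intro!: derivative_eq_intros H_deriv simp: mult.commute)
  show thesis
  proof (rule that[of a Q])
    show "a k > 0" if "k \<in> ?J" for k using a(1) that .
    show "(\<Sum>j\<in>?J. Q k j * H j l t) = (\<Sum>j\<in>?J. Q k j * H j l 0)"
      if "k \<in> ?J" "l \<in> ?J" "\<sigma> k < \<sigma> l" for k l t
    proof -
      have "((\<lambda>t. \<Sum>j\<in>?J. Q k j * H j l t) has_real_derivative 0) (at t)" for t
        using deriv[OF that(1), of l t] by (simp add: L(2)[OF that])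
      from DERIV_isconst_all[OF allI[OF this]] show ?thesis .
    qed
    show "(\<Sum>j\<in>?J. Q k j * H j k t) = a k * t + (\<Sum>j\<in>?J. Q k j * H j k 0)" if "k \<in> ?J" for k t
    proof -
      have "((\<lambda>t. (\<Sum>j\<in>?J. Q k j * H j k t) - a k * t) has_real_derivative 0) (at t)" for t
        using DERIV_diff[OF deriv[OF that, of k t] DERIV_cmult_Id[of "a k"]] by (simp add: a(2)[OF that])
      from DERIV_isconst_all[OF allI[OF this], of t 0] show ?thesis by simp
    qed
    fix x
    define y where "y = (\<lambda>j. if j \<in> ?J then F x j else 0)"
    have "L k y = (\<Sum>j\<in>?J. Q k j * F x j)" if "k \<in> ?J" for k
      unfolding y_def using linear_on_finite_support[OF L(1)[OF that], of ?J "F x"]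
      by (simp add: Q_def e_def mult.commute)
    then have "(\<Sum>k\<in>?J. (\<Sum>j\<in>?J. Q k j * F x j)\<^sup>2) = B y y" by (simp add: L(4))
    also have "\<dots> = (\<Sum>j\<in>?J. (F x j)\<^sup>2)"
      unfolding B_def y_def power2_eq_square by (intro sum.cong) auto
    finally show "(\<Sum>k\<in>?J. (\<Sum>j\<in>?J. Q k j * F x j)\<^sup>2) = (\<Sum>j\<in>?J. (F x j)\<^sup>2)" .
  qed
qed

text \<open>Total mass 1 determines the factor in front of e. This matches normalising constants
  without the determinant of the matrix that relates two models.\<close>

lemma scale_eq_of_prob_density:
  fixes e :: "'a \<Rightarrow> real"
  assumes [measurable]: "e \<in> borel_measurable M" and "K > 0" "K' > 0" and "\<And>x. e x \<ge> 0"
    and prob: "prob_space (density M (\<lambda>x. ennreal (K * e x)))"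
      "prob_space (density M (\<lambda>x. ennreal (K' * e x)))"
  shows "K = K'"
proof -
  have *: "(\<integral>\<^sup>+ x. ennreal (e x) \<partial>M) * ennreal C = 1"
    if "prob_space (density M (\<lambda>x. ennreal (C * e x)))" "C > 0" for C
  proof -
    have "1 = emeasure (density M (\<lambda>x. ennreal (C * e x))) (space M)"
      using prob_space.emeasure_space_1[OF that(1)] by simp
    also have "\<dots> = (\<integral>\<^sup>+ x. ennreal (C * e x) \<partial>M)"
      by (subst emeasure_density) (auto intro!: nn_integral_cong)
    also have "\<dots> = ennreal C * (\<integral>\<^sup>+ x. ennreal (e x) \<partial>M)"
      using that assms by (simp add: ennreal_mult nn_integral_cmult)
    finally show ?thesis by (simp add: mult.commute)
  qed
  have "(\<integral>\<^sup>+ x. ennreal (e x) \<partial>M) * ennreal K = (\<integral>\<^sup>+ x. ennreal (e x) \<partial>M) * ennreal K'"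
    using *[OF prob(1)] *[OF prob(2)] assms by simp
  \<comment> \<open>A positive multiple of the integral of e equals 1, so the integral is finite and
    nonzero and can be cancelled.\<close>
  moreover have "(\<integral>\<^sup>+ x. ennreal (e x) \<partial>M) \<noteq> top" "(\<integral>\<^sup>+ x. ennreal (e x) \<partial>M) \<noteq> 0"
    using *[OF prob(1)] assms by (auto simp: ennreal_top_mult)
  ultimately have "ennreal K = ennreal K'"
    by (simp add: ennreal_mult_cancel_left)
  then show ?thesis using assms by simp
qed

section \<open>Realisation on a product space and transfer of means\<close>

lemma indep_vars_PiM_coordinates:
  assumes "\<And>j. j \<in> J \<Longrightarrow> prob_space (N j)" and sets: "\<And>j. j \<in> J \<Longrightarrow> sets (N j) = sets (K j)"
  shows "prob_space.indep_vars (PiM J N) K (\<lambda>j \<omega>. \<omega> j) J"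
proof -
  interpret prob_space "PiM J N" by (rule prob_space_PiM) (rule assms(1))
  have rv: "random_variable (K j) (\<lambda>\<omega>. \<omega> j)" if "j \<in> J" for j
    using measurable_component_singleton[OF that, of N] measurable_cong_sets[OF refl sets[OF that]]
    by blast
  show ?thesis
  proof (cases "J = {}")
    case True
    then show ?thesis unfolding indep_vars_def indep_sets_def by simp
  next
    case False
    have "distr (PiM J N) (PiM J K) (\<lambda>\<omega>. \<lambda>j\<in>J. \<omega> j) = distr (PiM J N) (PiM J N) (\<lambda>\<omega>. \<omega>)"
      using sets by (intro distr_cong sets_PiM_cong)
        (auto simp: space_PiM PiE_def extensional_restrict)
    also have "\<dots> = PiM J (\<lambda>j. distr (PiM J N) (K j) (\<lambda>\<omega>. \<omega> j))"
    proof -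
      have "distr (PiM J N) (K j) (\<lambda>\<omega>. \<omega> j) = N j" if "j \<in> J" for j
      proof -
        have "distr (PiM J N) (K j) (\<lambda>\<omega>. \<omega> j) = distr (PiM J N) (N j) (\<lambda>\<omega>. \<omega> j)"
          using sets[OF that] by (intro distr_cong) auto
        also have "\<dots> = N j" by (rule distr_PiM_component[OF assms(1) that])
        finally show ?thesis .
      qed
      then have "PiM J (\<lambda>j. distr (PiM J N) (K j) (\<lambda>\<omega>. \<omega> j)) = PiM J N"
        by (intro PiM_cong) auto
      then show ?thesis by (simp add: distr_id)
    qed
    finally show ?thesis
      using indep_vars_iff_distr_eq_PiM'[OF False rv] by simp
  qed
qed

lemma distributed_PiM_coordinate:
  assumes "\<And>j. j \<in> J \<Longrightarrow> prob_space (density lborel (\<phi> j))" and "i \<in> J"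
    and "\<phi> i \<in> borel_measurable (borel :: real measure)"
  shows "distributed (PiM J (\<lambda>j. density lborel (\<phi> j))) lborel (\<lambda>\<omega>. \<omega> i) (\<phi> i)"
  unfolding distributed_def
proof (intro conjI)
  let ?M = "PiM J (\<lambda>j. density lborel (\<phi> j))"
  have "distr ?M lborel (\<lambda>\<omega>. \<omega> i) = distr ?M (density lborel (\<phi> i)) (\<lambda>\<omega>. \<omega> i)"
    by (intro distr_cong) auto
  also have "\<dots> = density lborel (\<phi> i)"
    by (rule distr_PiM_component[OF assms(1,2)])
  finally show "distr ?M lborel (\<lambda>\<omega>. \<omega> i) = density lborel (\<phi> i)" .
  show "(\<lambda>\<omega>. \<omega> i) \<in> measurable ?M lborel"
    using measurable_component_singleton[OF assms(2), of "\<lambda>j. density lborel (\<phi> j)"]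
    by (simp cong: measurable_cong_sets)
qed (use assms(3) in simp)

text \<open>Integrability and mean of a function of one coordinate are properties of the law P, so
  centring can be carried from one realisation of P to another.\<close>

lemma coordinate_integral_distr:
  fixes h :: "real \<Rightarrow> real"
  assumes X: "\<And>j. j \<in> J \<Longrightarrow> (\<lambda>\<omega>. X \<omega> j) \<in> borel_measurable M"
    and P: "P = distr M (PiM J (\<lambda>_. borel)) (\<lambda>\<omega>. restrict (X \<omega>) J)"
    and l: "l \<in> J" and h[measurable]: "h \<in> borel_measurable borel"
  shows "integrable P (\<lambda>x. h (x l)) \<longleftrightarrow> integrable M (\<lambda>\<omega>. h (X \<omega> l))"
    and "(\<integral>x. h (x l) \<partial>P) = (\<integral>\<omega>. h (X \<omega> l) \<partial>M)"
proof -
  have [measurable]: "(\<lambda>\<omega>. restrict (X \<omega>) J) \<in> measurable M (PiM J (\<lambda>_. borel))"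
    using X by (intro measurable_restrict)
  have "(\<lambda>x. x l) \<in> measurable (PiM J (\<lambda>_. borel)) (borel :: real measure)"
    using l by (rule measurable_component_singleton)
  then have [measurable]: "(\<lambda>x. h (x l)) \<in> borel_measurable (PiM J (\<lambda>_. borel))"
    by (rule measurable_compose) simp
  show "integrable P (\<lambda>x. h (x l)) \<longleftrightarrow> integrable M (\<lambda>\<omega>. h (X \<omega> l))"
    "(\<integral>x. h (x l) \<partial>P) = (\<integral>\<omega>. h (X \<omega> l) \<partial>M)"
    unfolding P using l by (simp_all add: integrable_distr_eq integral_distr)
qed

lemma plsem_generates_prob_space:
  assumes "plsem_generates p E \<mu> f s P"
  shows "prob_space P"
  using assms
proof (rule plsem_generatesE)
  fix M :: "(nat \<Rightarrow> real) measure" and \<epsilon> X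
  assume M: "prob_space M" and X: "\<And>j. j \<in> {1..p} \<Longrightarrow> (\<lambda>\<omega>. X \<omega> j) \<in> borel_measurable M"
    and P: "P = distr M (PiM {1..p} (\<lambda>_. borel)) (\<lambda>\<omega>. restrict (X \<omega>) {1..p})"
  have "(\<lambda>\<omega>. restrict (X \<omega>) {1..p}) \<in> measurable M (PiM {1..p} (\<lambda>_. borel))"
    by (intro measurable_restrict X)
  then show ?thesis unfolding P by (rule prob_space.prob_space_distr[OF M])
qed

text \<open>The edge functions are integrable by definition of a PLSEM. The diagonal summand is a
  multiple of X_j, which the structural equation writes as a sum of these, a constant and Gaussian
  noise.\<close>

lemma (in additive_model) integrable_H:
  assumes gen: "plsem_generates p E \<mu> f s P" and jl: "j \<in> {1..p}" "l \<in> {1..p}"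
  shows "integrable P (\<lambda>x. H j l (x l))"
  using gen
proof (rule plsem_generatesE)
  fix M :: "(nat \<Rightarrow> real) measure" and \<epsilon> X
  assume M: "prob_space M"
    and dist: "\<And>j. j \<in> {1..p} \<Longrightarrow> distributed M lborel (\<epsilon> j) (\<lambda>x. ennreal (normal_density 0 (s j) x))"
    and X: "\<And>j. j \<in> {1..p} \<Longrightarrow> (\<lambda>\<omega>. X \<omega> j) \<in> borel_measurable M"
    and eq: "\<And>\<omega> j. \<omega> \<in> space M \<Longrightarrow> j \<in> {1..p} \<Longrightarrow>
       X \<omega> j = \<mu> j + (\<Sum>i\<in>pa E j. f j i (X \<omega> i)) + \<epsilon> j \<omega>"
    and int_f: "\<And>i j. (i, j) \<in> E \<Longrightarrow> integrable M (\<lambda>\<omega>. f j i (X \<omega> i))"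
    and P: "P = distr M (PiM {1..p} (\<lambda>_. borel)) (\<lambda>\<omega>. restrict (X \<omega>) {1..p})"
  interpret prob_space M by fact
  have "integrable lborel (\<lambda>x. normal_density 0 (s j) x * x)"
    using s_pos[OF jl(1)] by (rule integrable_normal_moment_nz_1)
  then have "integrable M (\<epsilon> j)"
    using distributed_integrable_var[OF dist[OF jl(1)]] by simp
  then have "integrable M (\<lambda>\<omega>. \<mu> j + (\<Sum>i\<in>pa E j. f j i (X \<omega> i)) + \<epsilon> j \<omega>)"
    by (intro Bochner_Integration.integrable_add Bochner_Integration.integrable_sum int_f)
      (auto simp: pa_def)
  then have int_X: "integrable M (\<lambda>\<omega>. X \<omega> j)"
    using eq[OF _ jl(1)] by (simp cong: Bochner_Integration.integrable_cong)
  have "integrable M (\<lambda>\<omega>. H j l (X \<omega> l))"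
    using int_X int_f[of l j]
    by (cases "l = j"; cases "l \<in> pa E j") (simp_all add: H_def pa_def)
  moreover have "H j l \<in> borel_measurable borel"
    by (intro borel_measurable_continuous_onI C2_continuous C2_H)
  ultimately show ?thesis
    using coordinate_integral_distr(1)[OF X P jl(2), of "H j l"] by simp
qed

lemma in_S_perms_if_respects_V_set:
  assumes gen: "plsem_generates p E \<mu> f s P" and perm: "\<sigma> permutes {1..p}"
    and V: "\<And>i j. (i, j) \<in> V_set p (plsem_fun E \<mu> f s) \<Longrightarrow> \<sigma> i < \<sigma> j"
  shows "\<sigma> \<in> S_perms p P"
proof -
  let ?J = "{1..p}"
  obtain c where model: "additive_model p E f s c"
    using plsem_generates_ex_model[OF gen] by blast
  then interpret F: additive_model p E \<mu> f s c .
  interpret P: prob_space P by (rule plsem_generates_prob_space[OF gen])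
  obtain Q a where a: "\<And>k. k \<in> ?J \<Longrightarrow> a k > 0"
    and above: "\<And>k l t. k \<in> ?J \<Longrightarrow> l \<in> ?J \<Longrightarrow> \<sigma> k < \<sigma> l \<Longrightarrow>
      (\<Sum>j\<in>?J. Q k j * F.H j l t) = (\<Sum>j\<in>?J. Q k j * F.H j l 0)"
    and diag: "\<And>k t. k \<in> ?J \<Longrightarrow>
      (\<Sum>j\<in>?J. Q k j * F.H j k t) = a k * t + (\<Sum>j\<in>?J. Q k j * F.H j k 0)"
    and squares: "\<And>x. (\<Sum>k\<in>?J. (\<Sum>j\<in>?J. Q k j * F.F x j)\<^sup>2) = (\<Sum>j\<in>?J. (F.F x j)\<^sup>2)"
    by (rule F.triangular_representation[of \<sigma>, OF V]) blast+
  \<comment> \<open>\<open>g k l\<close> is the part of (QF)_k depending on x_l. Solving (QF)_k for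
    x_k suggests the edge functions \<open>- g k l t / a k\<close>, recentred by their means under
    P, and the noise scale \<open>1 / a k\<close>.\<close>
  define g where "g k l t = (\<Sum>j\<in>?J. Q k j * F.H j l t)" for k l t
  define m where "m k l = (\<integral>x. g k l (x l) \<partial>P)" for k l
  define f' where "f' k l t = (- 1 / a k) * g k l t + (0 * t + m k l / a k)" for k l t
  \<comment> \<open>Pairs with vanishing \<open>f'\<close> are left out, since a PLSEM admits no
    zero edge function.\<close>
  define E' where "E' = {(l, k). l \<in> ?J \<and> k \<in> ?J \<and> \<sigma> l < \<sigma> k \<and> (\<exists>t. f' k l t \<noteq> 0)}"
  define s' where "s' k = 1 / a k" for k
  define below where "below k = {l \<in> ?J. \<sigma> l < \<sigma> k}" for k
  define beyond where "beyond k = {l \<in> ?J. \<sigma> k < \<sigma> l}" for k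
  \<comment> \<open>Collected here: the intercepts of F, the diagonal at 0, the summands beyond k,
    which are constant by \<open>above\<close>, and the means moved out of the edge
    functions.\<close>
  define \<mu>' where "\<mu>' k = ((\<Sum>j\<in>?J. Q k j * (\<mu> j / s j)) - g k k 0 - (\<Sum>l\<in>beyond k. g k l 0)
      - (\<Sum>l\<in>below k. m k l)) / a k" for k
  have C2_g: "C2 (g k l)" for k l
    unfolding g_def by (intro C2_sum C2_cmult F.C2_H)
  have C2_f': "C2 (f' k l)" for k l
    unfolding f'_def[abs_def] by (intro C2_add C2_cmult C2_affine C2_g)
  have model': "additive_model p E' f' s' \<sigma>"
    by unfold_locales (auto simp: E'_def s'_def a C2_f')
  then interpret G: additive_model p E' \<mu>' f' s' \<sigma> .
  have G_eq: "G.F x k = (\<Sum>j\<in>?J. Q k j * F.F x j)" if k: "k \<in> ?J" for x k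
  proof -
    have "(\<Sum>j\<in>?J. Q k j * F.F x j)
        = (\<Sum>j\<in>?J. \<Sum>l\<in>?J. Q k j * F.H j l (x l)) - (\<Sum>j\<in>?J. Q k j * (\<mu> j / s j))"
      by (simp add: F.F_sum right_diff_distrib sum_subtractf sum_distrib_left)
    also have "(\<Sum>j\<in>?J. \<Sum>l\<in>?J. Q k j * F.H j l (x l)) = (\<Sum>l\<in>?J. g k l (x l))"
      unfolding g_def by (rule sum.swap)
    also have "(\<Sum>l\<in>?J. g k l (x l))
        = g k k (x k) + (\<Sum>l\<in>below k. g k l (x l)) + (\<Sum>l\<in>beyond k. g k l (x l))"
    proof -
      have "\<sigma> l < \<sigma> k \<or> \<sigma> k < \<sigma> l \<longleftrightarrow> l \<noteq> k" for l
        unfolding neq_iff[symmetric] inj_eq[OF permutes_inj[OF perm]] ..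
      then have "?J - {k} = below k \<union> beyond k"
        unfolding below_def beyond_def by blast
      moreover have "(\<Sum>l\<in>below k \<union> beyond k. g k l (x l))
          = (\<Sum>l\<in>below k. g k l (x l)) + (\<Sum>l\<in>beyond k. g k l (x l))"
        by (intro sum.union_disjoint) (auto simp: below_def beyond_def)
      ultimately show ?thesis
        using k by (subst sum.remove[of _ k]) auto
    qed
    also have "(\<Sum>l\<in>beyond k. g k l (x l)) = (\<Sum>l\<in>beyond k. g k l 0)"
      unfolding g_def by (intro sum.cong refl above[OF k]) (auto simp: beyond_def)
    also have "g k k (x k) = a k * x k + g k k 0"
      unfolding g_def by (rule diag[OF k])
    finally have rhs: "(\<Sum>j\<in>?J. Q k j * F.F x j) = a k * x k + (\<Sum>l\<in>below k. g k l (x l))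
        - (\<Sum>l\<in>below k. m k l) - a k * \<mu>' k"
      using a[OF k] by (simp add: \<mu>'_def)
    \<comment> \<open>Omitted edges have zero \<open>f'\<close>, so the sum may run over all earlier
      indices.\<close>
    have "(\<Sum>l\<in>pa E' k. f' k l (x l)) = (\<Sum>l\<in>below k. f' k l (x l))"
      by (intro sum.mono_neutral_left) (use k in \<open>auto simp: pa_def E'_def below_def\<close>)
    also have "\<dots> = - ((\<Sum>l\<in>below k. g k l (x l)) - (\<Sum>l\<in>below k. m k l)) / a k"
      by (simp add: f'_def sum_subtractf sum_negf sum_divide_distrib diff_divide_distrib sum.distrib)
    finally have "a k * (\<Sum>l\<in>pa E' k. f' k l (x l))
        = (\<Sum>l\<in>below k. m k l) - (\<Sum>l\<in>below k. g k l (x l))"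
      using a[OF k] by simp
    moreover have "G.F x k = a k * x k - a k * \<mu>' k - a k * (\<Sum>l\<in>pa E' k. f' k l (x l))"
      by (simp add: plsem_fun_def s'_def algebra_simps)
    ultimately show ?thesis unfolding rhs by simp
  qed
  define N where "N j = density lborel (\<lambda>x. ennreal (normal_density 0 (s' j) x))" for j
  define M' where "M' = PiM ?J N"
  have prob_N: "prob_space (N j)" if "j \<in> ?J" for j
    unfolding N_def using G.s_pos[OF that] by (rule prob_space_normal_density)
  interpret M': prob_space M' unfolding M'_def by (rule prob_space_PiM) (rule prob_N)
  have indep: "prob_space.indep_vars M' (\<lambda>_. borel) (\<lambda>j \<omega>. \<omega> j) ?J"
    unfolding M'_def by (intro indep_vars_PiM_coordinates prob_N) (simp_all add: N_def)
  have dist: "distributed M' lborel (\<lambda>\<omega>. \<omega> j) (\<lambda>x. ennreal (normal_density 0 (s' j) x))"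
    if "j \<in> ?J" for j
    unfolding M'_def N_def
    by (rule distributed_PiM_coordinate[OF prob_N[unfolded N_def] that]) simp_all
  obtain X where X: "\<And>\<omega> j. X \<omega> j = \<mu>' j + (\<Sum>i\<in>pa E' j. f' j i (X \<omega> i)) + \<omega> j"
    using G.solution_exists by blast
  have "sets M' = sets (PiM ?J (\<lambda>_. lborel))"
    unfolding M'_def by (intro sets_PiM_cong) (simp_all add: N_def)
  then have X_meas: "(\<lambda>\<omega>. X \<omega> j) \<in> borel_measurable M'" for j
    using G.solution_measurable[OF X, of j ?J] measurable_cong_sets by blast
  \<comment> \<open>By \<open>G_eq\<close> and \<open>squares\<close> the exponent is common to both
    laws; only the constants remain to be matched.\<close>
  define e where "e x = exp (- (\<Sum>j\<in>?J. (F.F x j)\<^sup>2) / 2)" for x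
  let ?P' = "distr M' (PiM ?J (\<lambda>_. borel)) (\<lambda>\<omega>. restrict (X \<omega>) ?J)"
  have P: "P = density (PiM ?J (\<lambda>_. lborel)) (\<lambda>x. ennreal (F.normalizer * e x))"
    unfolding e_def by (rule plsem_generates_density[OF gen model])
  have P': "?P' = density (PiM ?J (\<lambda>_. lborel)) (\<lambda>x. ennreal (G.normalizer * e x))"
  proof -
    have "?P' = density (PiM ?J (\<lambda>_. lborel))
        (\<lambda>x. ennreal (G.normalizer * exp (- (\<Sum>j\<in>?J. (G.F x j)\<^sup>2) / 2)))"
      by (rule G.law_density[OF M'.prob_space_axioms indep dist X])
    then show ?thesis by (simp add: e_def G_eq squares)
  qed
  have "(\<lambda>\<omega>. restrict (X \<omega>) ?J) \<in> measurable M' (PiM ?J (\<lambda>_. borel))"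
    by (intro measurable_restrict X_meas)
  then have "prob_space ?P'" by (rule M'.prob_space_distr)
  moreover have "e \<in> borel_measurable (PiM ?J (\<lambda>_. lborel))" "\<And>x. e x \<ge> 0"
    unfolding e_def[abs_def] by simp_all
  ultimately have "F.normalizer = G.normalizer"
    using P.prob_space_axioms F.normalizer_pos G.normalizer_pos unfolding P P'
    by (intro scale_eq_of_prob_density[of e "PiM ?J (\<lambda>_. lborel)"])
  then have law: "P = ?P'" using P P' by simp
  \<comment> \<open>The means were computed under P; \<open>law\<close> identifies P with the law of
    the new X and so carries them to \<open>M'\<close>.\<close>
  have centered: "integrable M' (\<lambda>\<omega>. f' k l (X \<omega> l)) \<and> (\<integral>\<omega>. f' k l (X \<omega> l) \<partial>M') = 0"
    if kl: "k \<in> ?J" "l \<in> ?J" for k l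
  proof -
    have int_g: "integrable P (\<lambda>x. g k l (x l))"
      unfolding g_def by (intro Bochner_Integration.integrable_sum integrable_mult_right
          F.integrable_H[OF gen _ kl(2)])
    then have "integrable P (\<lambda>x. f' k l (x l))" by (simp add: f'_def)
    moreover have "(\<integral>x. f' k l (x l) \<partial>P) = 0"
      using int_g by (simp add: f'_def m_def P.prob_space)
    moreover have "f' k l \<in> borel_measurable borel"
      by (intro borel_measurable_continuous_onI C2_continuous C2_f')
    ultimately show ?thesis
      using coordinate_integral_distr[OF X_meas law kl(2), of "f' k l"] by simp
  qed
  have "plsem_generates p E' \<mu>' f' s' P"
    unfolding plsem_generates_def
  proof (intro conjI exI[of _ M'] exI[of _ "\<lambda>j \<omega>. \<omega> j"] exI[of _ X])
    have "acyclic E'"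
      by (rule acyclic_subset[OF wf_acyclic[OF wf_inv_image[OF wf_less_than, of \<sigma>]]])
        (auto simp: E'_def)
    then show "is_dag p E'" by (auto simp: is_dag_def E'_def)
    show "\<forall>j\<in>?J. s' j > 0" using G.s_pos by blast
    show "\<forall>(i, j)\<in>E'. C2 (f' j i) \<and> (\<exists>x. f' j i x \<noteq> 0)"
      using C2_f' by (auto simp: E'_def)
    show "\<forall>(i, j)\<in>E'. integrable M' (\<lambda>\<omega>. f' j i (X \<omega> i)) \<and> (\<integral>\<omega>. f' j i (X \<omega> i) \<partial>M') = 0"
      using centered by (auto simp: E'_def)
  qed (use M'.prob_space_axioms indep dist X_meas X law in blast)+
  moreover have "\<forall>(i, j)\<in>E'. \<sigma> i < \<sigma> j" by (auto simp: E'_def)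
  ultimately show ?thesis using perm unfolding S_perms_def by blast
qed

theorem mainTheorem4:
  fixes p :: nat and P :: "(nat \<Rightarrow> real) measure"
    and E :: "(nat \<times> nat) set" and \<mu> :: "nat \<Rightarrow> real"
    and f :: "nat \<Rightarrow> nat \<Rightarrow> real \<Rightarrow> real" and s :: "nat \<Rightarrow> real"
  assumes "plsem_generates p E \<mu> f s P"
  shows "S_perms p P =
    {\<sigma>. \<sigma> permutes {1..p} \<and> (\<forall>(i, j)\<in>V_set p (plsem_fun E \<mu> f s). \<sigma> i < \<sigma> j)}"
proof (intro equalityI subsetI)
  fix \<sigma> assume \<sigma>: "\<sigma> \<in> S_perms p P"
  then have "\<sigma> permutes {1..p}" unfolding S_perms_def by blast
  moreover have "\<forall>(i, j)\<in>V_set p (plsem_fun E \<mu> f s). \<sigma> i < \<sigma> j"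
    using S_perms_respects_V_set[OF assms \<sigma>] by blast
  ultimately show "\<sigma> \<in> {\<sigma>. \<sigma> permutes {1..p} \<and>
      (\<forall>(i, j)\<in>V_set p (plsem_fun E \<mu> f s). \<sigma> i < \<sigma> j)}" by blast
next
  fix \<sigma> assume "\<sigma> \<in> {\<sigma>. \<sigma> permutes {1..p} \<and>
      (\<forall>(i, j)\<in>V_set p (plsem_fun E \<mu> f s). \<sigma> i < \<sigma> j)}"
  then show "\<sigma> \<in> S_perms p P"
    by (intro in_S_perms_if_respects_V_set[OF assms]) blast+
qed

end
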